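(* Let $m \geq 2$ and put $n = 2m-1$. For every prime power $q$ there exists a $(4,2)$-set $X_q$ in $\mathrm{PG}(n,q)$ with $|X_q| = (1+o(1))\, q^{\frac{n-1}{2}}$ as $q \to \infty$.
   Context: $\mathrm{PG}(n,q)$ is the projective space whose points are the $1$-dimensional subspaces of $\mathbb{F}_q^{n+1}$; a plane is a $3$-dimensional vector subspace. A $(4,2)$-set is a set of points such that every plane contains at most $4$ of its points. *)

theory Defs
  imports
    "Jordan_Normal_Form.Missing_VectorSpace"
    "HOL-Number_Theory.Prime_Powers"
    "HOL-Library.Landau_Symbols"
begin

text \<open>
  The coordinate space \<open>K\<^sup>n\<^sup>+\<^sup>1\<close> is the space of functions from \<open>{0..n}\<close> to the carrier of \<open>K\<close>.
\<close>

definition coord_space :: "('a, 'b) ring_scheme \<Rightarrow> nat \<Rightarrow> ('a, nat \<Rightarrow> 'a) module" where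
  "coord_space K n = ring.func_space K {0..n}"

text \<open>The dimension \<open>k\<close> is the vector space dimension, not the projective one.\<close>

definition PG_subspaces :: "('a, 'b) ring_scheme \<Rightarrow> nat \<Rightarrow> nat \<Rightarrow> (nat \<Rightarrow> 'a) set set" where
  "PG_subspaces K n k =
     {W. VectorSpace.subspace K W (coord_space K n) \<and>
         vectorspace.dim K (coord_space K n\<lparr>carrier := W\<rparr>) = k}"

definition PG_points :: "('a, 'b) ring_scheme \<Rightarrow> nat \<Rightarrow> (nat \<Rightarrow> 'a) set set" where
  "PG_points K n = PG_subspaces K n 1"

definition PG_planes :: "('a, 'b) ring_scheme \<Rightarrow> nat \<Rightarrow> (nat \<Rightarrow> 'a) set set" where
  "PG_planes K n = PG_subspaces K n 3"

definition four_two_set :: "('a, 'b) ring_scheme \<Rightarrow> nat \<Rightarrow> (nat \<Rightarrow> 'a) set set \<Rightarrow> bool" where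
  "four_two_set K n X \<longleftrightarrow>
     X \<subseteq> PG_points K n \<and>
     (\<forall>E \<in> PG_planes K n. finite {P \<in> X. P \<subseteq> E} \<and> card {P \<in> X. P \<subseteq> E} \<le> 4)"

end

theory Submission
  imports Defs
    "HOL-Algebra.Multiplicative_Group"
    "HOL-Algebra.Subrings"
    "HOL-Computational_Algebra.Polynomial"
begin

text \<open>
  Let \<open>K\<close> be the extension of \<open>F = GF(q)\<close> of degree \<open>m\<close>, identify \<open>F\<^sup>2\<^sup>m\<close> with \<open>K \<times> K\<close>, and
  let \<open>\<tau> : K \<rightarrow> F\<close> be a nonzero linear form. The set consists of the \<open>q\<^sup>m\<^sup>-\<^sup>1\<close> points spanned by
  \<open>(x, 1/x)\<close> with \<open>\<tau>(x) = 1\<close>.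

  A linear relation between the vectors \<open>(x, 1/x)\<close> is also one between the triples \<open>(1, x, 1/x)\<close>,
  so a Vandermonde determinant shows that no three of the points are collinear. If five of them,
  given by \<open>x\<^sub>1, \<dots>, x\<^sub>5\<close>, were coplanar, there would be relations \<open>\<lambda>\<close> on \<open>x\<^sub>1, x\<^sub>2, x\<^sub>3, x\<^sub>4\<close> and
  \<open>\<mu>\<close> on \<open>x\<^sub>1, x\<^sub>2, x\<^sub>3, x\<^sub>5\<close> with all coefficients nonzero. Both \<open>\<lambda>\<^sub>i (x\<^sub>i - x\<^sub>4)\<close> and
  \<open>\<mu>\<^sub>i (x\<^sub>i - x\<^sub>5)\<close>, for \<open>i \<le> 3\<close>, are orthogonal to \<open>(1, 1, 1)\<close> and \<open>(1/x\<^sub>i)\<close>, so they differ by a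
  factor \<open>z \<in> K\<close>; with \<open>1/x\<close> in place of \<open>x\<close> the factor is \<open>w = z x\<^sub>5 / x\<^sub>4\<close>. Then \<open>z \<noteq> w\<close> are the
  two roots of a quadratic polynomial over \<open>F\<close>. Applying \<open>\<tau>\<close> to \<open>(z + w) w x\<^sub>4 = z w (x\<^sub>4 + x\<^sub>5)\<close>
  and to the expression of \<open>x\<^sub>1\<close> through \<open>x\<^sub>4\<close>, \<open>x\<^sub>5\<close> and \<open>w x\<^sub>4\<close> gives \<open>(z + w)\<^sup>2 = 4 z w\<close>, that is
  \<open>z = w\<close>.

  The hypotheses provide \<open>K\<close> as the field of order \<open>q\<^sup>m\<close>. It contains a copy of \<open>F\<close>: a monic integer
  polynomial of least degree that vanishes at a generator of the multiplicative group of \<open>F\<close> divides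
  \<open>X\<^sup>N - X\<close>, \<open>N = q\<^sup>m\<close>, modulo the characteristic, and hence has a root in \<open>K\<close>.
\<close>

hide_const (open) UnivPoly.coeff UnivPoly.monom Module.smult Polynomial.order

section \<open>Linear relations between the vectors \<open>(x, 1/x)\<close>\<close>

context field
begin

text \<open>As \<open>y2 \<noteq> y3\<close>, the rows \<open>(1, 1, 1)\<close> and
  \<open>(y1, y2, y3)\<close> have rank two and their common kernel is a line. A kernel vector is
  determined by its first entry, whence \<open>z = a1 / b1\<close>.\<close>

lemma kernel_pair_proportional:
  assumes c: "a1 \<in> carrier R" "a2 \<in> carrier R" "a3 \<in> carrier R"
      "b1 \<in> carrier R" "b2 \<in> carrier R" "b3 \<in> carrier R"
      "y1 \<in> carrier R" "y2 \<in> carrier R" "y3 \<in> carrier R"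
    and "a1 \<oplus> a2 \<oplus> a3 = \<zero>" "a1 \<otimes> y1 \<oplus> a2 \<otimes> y2 \<oplus> a3 \<otimes> y3 = \<zero>"
    and "b1 \<oplus> b2 \<oplus> b3 = \<zero>" "b1 \<otimes> y1 \<oplus> b2 \<otimes> y2 \<oplus> b3 \<otimes> y3 = \<zero>"
    and "y2 \<noteq> y3" "b1 \<noteq> \<zero>"
  obtains z where "z \<in> carrier R" "a1 = z \<otimes> b1" "a2 = z \<otimes> b2" "a3 = z \<otimes> b3"
proof -
  define z where "z = a1 \<otimes> inv b1"
  have z: "z \<in> carrier R" and 1: "a1 = z \<otimes> b1"
    using assms by (auto simp: z_def m_assoc field_Units)
  have third: "d3 = \<ominus> (d1 \<oplus> d2)" if "d1 \<oplus> d2 \<oplus> d3 = \<zero>"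
    "d1 \<in> carrier R" "d2 \<in> carrier R" "d3 \<in> carrier R" for d1 d2 d3
    using that by (metis a_comm minus_equality add.m_closed)
  have red: "d2 \<otimes> (y2 \<ominus> y3) = \<ominus> (d1 \<otimes> (y1 \<ominus> y3))"
    if s: "d1 \<oplus> d2 \<oplus> d3 = \<zero>" and t: "d1 \<otimes> y1 \<oplus> d2 \<otimes> y2 \<oplus> d3 \<otimes> y3 = \<zero>"
    and d: "d1 \<in> carrier R" "d2 \<in> carrier R" "d3 \<in> carrier R" for d1 d2 d3
  proof -
    have "d2 \<otimes> (y2 \<ominus> y3) \<oplus> d1 \<otimes> (y1 \<ominus> y3) =
        (d1 \<otimes> y1 \<oplus> d2 \<otimes> y2 \<oplus> d3 \<otimes> y3) \<ominus> (d1 \<oplus> d2 \<oplus> d3) \<otimes> y3"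
      using c d by algebra
    also have "\<dots> = \<zero>" using c d by (simp add: s t)
    finally show ?thesis using c d by (intro minus_equality[symmetric]) auto
  qed
  have "a2 \<otimes> (y2 \<ominus> y3) = \<ominus> (a1 \<otimes> (y1 \<ominus> y3))"
    using assms by (intro red[of a1 a2 a3]) auto
  also have "\<dots> = z \<otimes> (\<ominus> (b1 \<otimes> (y1 \<ominus> y3)))"
    unfolding 1 using c z by algebra
  also have "\<ominus> (b1 \<otimes> (y1 \<ominus> y3)) = b2 \<otimes> (y2 \<ominus> y3)"
    using assms by (intro red[of b1 b2 b3, symmetric]) auto
  finally have "a2 \<otimes> (y2 \<ominus> y3) = (z \<otimes> b2) \<otimes> (y2 \<ominus> y3)"
    using c z by (simp add: m_assoc)
  moreover have "y2 \<ominus> y3 \<noteq> \<zero>" using assms by simp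
  ultimately have 2: "a2 = z \<otimes> b2" using c z by (subst (asm) m_rcancel) auto
  have "a3 = \<ominus> (a1 \<oplus> a2)" "b3 = \<ominus> (b1 \<oplus> b2)" using assms by (auto intro: third)
  hence "a3 = z \<otimes> b3" unfolding 1 2 using c z by (simp add: r_distr r_minus)
  with z 1 2 show thesis by (intro that)
qed

text \<open>Subtracting the two equations exposes the factor \<open>z \<ominus> w\<close>. The
  leading coefficient is kept as a factor, so nothing has to be divided by it.\<close>

lemma quadratic_Vieta:
  assumes c: "a \<in> carrier R" "b \<in> carrier R" "c \<in> carrier R" "z \<in> carrier R" "w \<in> carrier R"
    and "a \<otimes> z \<otimes> z \<ominus> b \<otimes> z \<oplus> c = \<zero>" "a \<otimes> w \<otimes> w \<ominus> b \<otimes> w \<oplus> c = \<zero>" "z \<noteq> w"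
  shows "a \<otimes> (z \<oplus> w) = b" "a \<otimes> (z \<otimes> w) = c"
proof -
  have "(z \<ominus> w) \<otimes> (a \<otimes> (z \<oplus> w) \<ominus> b) = 
     (a \<otimes> z \<otimes> z \<ominus> b \<otimes> z \<oplus> c) \<ominus> (a \<otimes> w \<otimes> w \<ominus> b \<otimes> w \<oplus> c)"
    using c by algebra
  also have "\<dots> = \<zero>" using assms by simp
  finally show b: "a \<otimes> (z \<oplus> w) = b" using assms by (simp add: integral_iff)
  have "a \<otimes> (z \<otimes> w) = (a \<otimes> (z \<oplus> w)) \<otimes> z \<ominus> a \<otimes> z \<otimes> z"
    using c by algebra
  also have "\<dots> = c \<ominus> (a \<otimes> z \<otimes> z \<ominus> b \<otimes> z \<oplus> c)"
    unfolding b using c by algebra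
  also have "\<dots> = c" unfolding assms using c by algebra
  finally show "a \<otimes> (z \<otimes> w) = c" .
qed

lemma cross_term_expand:
  assumes "k \<in> carrier R" "l1 \<in> carrier R" "l2 \<in> carrier R" "m1 \<in> carrier R" "m2 \<in> carrier R" "z \<in> carrier R"
  shows "k \<otimes> ((l1 \<ominus> m1 \<otimes> z) \<otimes> (l2 \<ominus> m2 \<otimes> z)) =
    k \<otimes> (m1 \<otimes> m2) \<otimes> z \<otimes> z \<ominus> k \<otimes> (l1 \<otimes> m2 \<oplus> m1 \<otimes> l2) \<otimes> z \<oplus> k \<otimes> (l1 \<otimes> l2)"
  using assms by algebra

text \<open>Formally \<open>a_i = l_i d / (l_i - m_i z)\<close>, so \<open>s\<close> reads
  \<open>sum m_i l_i / (l_i - m_i z) = 0\<close>. Clearing denominators gives a quadratic equation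
  for \<open>z\<close> whose coefficients involve only the \<open>l_i\<close> and
  \<open>m_i\<close>.\<close>

lemma three_cross_terms:
  assumes c: "l1 \<in> carrier R" "l2 \<in> carrier R" "l3 \<in> carrier R"
    "m1 \<in> carrier R" "m2 \<in> carrier R" "m3 \<in> carrier R"
    "a1 \<in> carrier R" "a2 \<in> carrier R" "a3 \<in> carrier R" "d \<in> carrier R" "z \<in> carrier R"
    and e: "(l1 \<ominus> m1 \<otimes> z) \<otimes> a1 = l1 \<otimes> d" "(l2 \<ominus> m2 \<otimes> z) \<otimes> a2 = l2 \<otimes> d" "(l3 \<ominus> m3 \<otimes> z) \<otimes> a3 = l3 \<otimes> d"
    and s: "m1 \<otimes> a1 \<oplus> m2 \<otimes> a2 \<oplus> m3 \<otimes> a3 = \<zero>" and d: "d \<noteq> \<zero>"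
  shows "m1 \<otimes> m2 \<otimes> m3 \<otimes> (l1 \<oplus> l2 \<oplus> l3) \<otimes> z \<otimes> z
     \<ominus> (m1 \<otimes> l1 \<otimes> (l2 \<otimes> m3 \<oplus> m2 \<otimes> l3) \<oplus> m2 \<otimes> l2 \<otimes> (l1 \<otimes> m3 \<oplus> m1 \<otimes> l3) \<oplus> m3 \<otimes> l3 \<otimes> (l1 \<otimes> m2 \<oplus> m1 \<otimes> l2)) \<otimes> z
     \<oplus> l1 \<otimes> l2 \<otimes> l3 \<otimes> (m1 \<oplus> m2 \<oplus> m3) = \<zero>" (is "?L = _")
proof -
  define e1 e2 e3 where ed: "e1 = l1 \<ominus> m1 \<otimes> z" "e2 = l2 \<ominus> m2 \<otimes> z" "e3 = l3 \<ominus> m3 \<otimes> z"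
  have ec: "e1 \<in> carrier R" "e2 \<in> carrier R" "e3 \<in> carrier R" using c by (auto simp: ed)
  define Q where "Q = m1 \<otimes> l1 \<otimes> (e2 \<otimes> e3) \<oplus> m2 \<otimes> l2 \<otimes> (e1 \<otimes> e3) \<oplus> m3 \<otimes> l3 \<otimes> (e1 \<otimes> e2)"
  have Qc: "Q \<in> carrier R" using c ec by (auto simp: Q_def)
  \<comment> \<open>Replacing each \<open>l_i \<otimes> d\<close> by
    \<open>e_i \<otimes> a_i\<close> makes \<open>e1 \<otimes> e2 \<otimes> e3\<close> a common
    factor and leaves the sum in \<open>s\<close>. This way no \<open>e_i\<close> has to be
    inverted.\<close>
  have "d \<otimes> Q = m1 \<otimes> (l1 \<otimes> d) \<otimes> (e2 \<otimes> e3) \<oplus> m2 \<otimes> (l2 \<otimes> d) \<otimes> (e1 \<otimes> e3) \<oplus> m3 \<otimes> (l3 \<otimes> d) \<otimes> (e1 \<otimes> e2)"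
    unfolding Q_def using c ec by algebra
  also have "\<dots> = m1 \<otimes> (e1 \<otimes> a1) \<otimes> (e2 \<otimes> e3) \<oplus> m2 \<otimes> (e2 \<otimes> a2) \<otimes> (e1 \<otimes> e3) \<oplus> m3 \<otimes> (e3 \<otimes> a3) \<otimes> (e1 \<otimes> e2)"
    using e by (simp add: ed)
  also have "\<dots> = e1 \<otimes> e2 \<otimes> e3 \<otimes> (m1 \<otimes> a1 \<oplus> m2 \<otimes> a2 \<oplus> m3 \<otimes> a3)"
    using c ec by algebra
  also have "\<dots> = \<zero>" using c ec by (simp add: s)
  finally have "Q = \<zero>" using c Qc d by (simp add: integral_iff)
  moreover have "?L = Q"
  proof -
    \<comment> \<open>The middle coefficient of \<open>?L\<close> already has the shape that
      \<open>cross_term_expand\<close> yields; only the outer two are rearranged, by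
      \<open>lead\<close> and \<open>const\<close>.\<close>
    have collect: "(a1 \<otimes> z \<otimes> z \<ominus> b1 \<otimes> z \<oplus> c1) \<oplus> (a2 \<otimes> z \<otimes> z \<ominus> b2 \<otimes> z \<oplus> c2) \<oplus> (a3 \<otimes> z \<otimes> z \<ominus> b3 \<otimes> z \<oplus> c3)
      = (a1 \<oplus> a2 \<oplus> a3) \<otimes> z \<otimes> z \<ominus> (b1 \<oplus> b2 \<oplus> b3) \<otimes> z \<oplus> (c1 \<oplus> c2 \<oplus> c3)"
      if "a1 \<in> carrier R" "a2 \<in> carrier R" "a3 \<in> carrier R" "b1 \<in> carrier R" "b2 \<in> carrier R" "b3 \<in> carrier R"
        "c1 \<in> carrier R" "c2 \<in> carrier R" "c3 \<in> carrier R" for a1 a2 a3 b1 b2 b3 c1 c2 c3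
      using that c(11) by algebra
    have lead: "m1 \<otimes> l1 \<otimes> (m2 \<otimes> m3) \<oplus> m2 \<otimes> l2 \<otimes> (m1 \<otimes> m3) \<oplus> m3 \<otimes> l3 \<otimes> (m1 \<otimes> m2) =
        m1 \<otimes> m2 \<otimes> m3 \<otimes> (l1 \<oplus> l2 \<oplus> l3)"
      and const: "m1 \<otimes> l1 \<otimes> (l2 \<otimes> l3) \<oplus> m2 \<otimes> l2 \<otimes> (l1 \<otimes> l3) \<oplus> m3 \<otimes> l3 \<otimes> (l1 \<otimes> l2) =
        l1 \<otimes> l2 \<otimes> l3 \<otimes> (m1 \<oplus> m2 \<oplus> m3)"
      using c(1-6) by algebra+
    show ?thesis
      unfolding Q_def ed lead[symmetric] const[symmetric]
        cross_term_expand[OF m_closed[OF c(4,1)] c(2,3,5,6,11)]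
        cross_term_expand[OF m_closed[OF c(5,2)] c(1,3,4,6,11)]
        cross_term_expand[OF m_closed[OF c(6,3)] c(1,2,4,5,11)]
      by (rule collect[symmetric]; use c in simp)
  qed
  ultimately show ?thesis by simp
qed

text \<open>Inverses appear as variables \<open>y\<close>, \<open>y'\<close> so that later
  identities stay polynomial. This formula converts differences of inverses into differences of the
  elements themselves.\<close>

lemma inverse_diff:
  assumes "x \<in> carrier R" "y \<in> carrier R" "x' \<in> carrier R" "y' \<in> carrier R" "x \<otimes> y = \<one>" "x' \<otimes> y' = \<one>"
  shows "y \<ominus> y' = \<ominus> ((x \<ominus> x') \<otimes> y \<otimes> y')"
proof -
  have "\<ominus> ((x \<ominus> x') \<otimes> y \<otimes> y') = (x' \<otimes> y') \<otimes> y \<ominus> (x \<otimes> y) \<otimes> y'" using assms(1-4) by algebra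
  thus ?thesis using assms by simp
qed

end

section \<open>Relations over a subfield \<open>S\<close> between elements where the linear form
  \<open>T\<close> equals one\<close>

locale subfield_linear_map = field R for R (structure) +
  fixes S :: "'a set" and T :: "'a \<Rightarrow> 'a"
  assumes S: "subfield S R"
    and T_closed [simp]: "x \<in> carrier R \<Longrightarrow> T x \<in> carrier R"
    and T_add [simp]: "x \<in> carrier R \<Longrightarrow> y \<in> carrier R \<Longrightarrow> T (x \<oplus> y) = T x \<oplus> T y"
    and T_mult [simp]: "c \<in> S \<Longrightarrow> x \<in> carrier R \<Longrightarrow> T (c \<otimes> x) = c \<otimes> T x"
begin

lemma S_carrier [simp]: "c \<in> S \<Longrightarrow> c \<in> carrier R"
  using subfieldE(3)[OF S] by blast

lemma S_add [simp]: "a \<in> S \<Longrightarrow> b \<in> S \<Longrightarrow> a \<oplus> b \<in> S"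
  using subringE(7)[OF subfieldE(1)[OF S]] .

lemma S_mult [simp]: "a \<in> S \<Longrightarrow> b \<in> S \<Longrightarrow> a \<otimes> b \<in> S"
  using subringE(6)[OF subfieldE(1)[OF S]] .

lemma S_uminus [simp]: "a \<in> S \<Longrightarrow> \<ominus> a \<in> S"
  using subringE(5)[OF subfieldE(1)[OF S]] .

lemma S_inv [simp]: "a \<in> S \<Longrightarrow> a \<noteq> \<zero> \<Longrightarrow> inv a \<in> S"
  using subfield_m_inv(1)[OF S] by auto

lemma T_zero [simp]: "T \<zero> = \<zero>"
  using T_add[of \<zero> \<zero>] by (metis T_closed r_zero zero_closed add.r_cancel_one')

text \<open>Applying \<open>T\<close> to \<open>rx\<close> gives the third relation
  \<open>a \<oplus> b \<oplus> c = \<zero>\<close>. Eliminating \<open>c\<close> and then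
  \<open>b\<close> leaves \<open>a \<otimes> (x1 \<ominus> x3) \<otimes> (y1 \<ominus> y2) =
  \<zero>\<close>; permuting the indices treats the other coefficients.\<close>

lemma triple_independent:
  assumes s: "a \<in> S" "b \<in> S" "c \<in> S"
    and x: "x1 \<in> carrier R" "x2 \<in> carrier R" "x3 \<in> carrier R"
    and y: "y1 \<in> carrier R" "y2 \<in> carrier R" "y3 \<in> carrier R"
    and xy: "x1 \<otimes> y1 = \<one>" "x2 \<otimes> y2 = \<one>" "x3 \<otimes> y3 = \<one>"
    and T1: "T x1 = \<one>" "T x2 = \<one>" "T x3 = \<one>"
    and d: "x1 \<noteq> x2" "x1 \<noteq> x3"
    and rx: "a \<otimes> x1 \<oplus> b \<otimes> x2 \<oplus> c \<otimes> x3 = \<zero>" and ry: "a \<otimes> y1 \<oplus> b \<otimes> y2 \<oplus> c \<otimes> y3 = \<zero>"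
  shows "a = \<zero>"
proof -
  have sc: "a \<in> carrier R" "b \<in> carrier R" "c \<in> carrier R" using s by auto
  have sum: "a \<oplus> b \<oplus> c = \<zero>"
    using arg_cong[OF rx, of T] s x by (simp add: T1)
  \<comment> \<open>the determinant with rows \<open>1\<close>, \<open>x\<close>, \<open>y\<close> is a Vandermonde determinant up to a unit\<close>
  have 1: "a \<otimes> (x1 \<ominus> x3) \<oplus> b \<otimes> (x2 \<ominus> x3) = \<zero>"
  proof -
    have "a \<otimes> (x1 \<ominus> x3) \<oplus> b \<otimes> (x2 \<ominus> x3) =
      (a \<otimes> x1 \<oplus> b \<otimes> x2 \<oplus> c \<otimes> x3) \<ominus> (a \<oplus> b \<oplus> c) \<otimes> x3" using sc x by algebra
    thus ?thesis using x by (simp add: rx sum)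
  qed
  have 2: "a \<otimes> (y1 \<ominus> y3) \<oplus> b \<otimes> (y2 \<ominus> y3) = \<zero>"
  proof -
    have "a \<otimes> (y1 \<ominus> y3) \<oplus> b \<otimes> (y2 \<ominus> y3) =
      (a \<otimes> y1 \<oplus> b \<otimes> y2 \<oplus> c \<otimes> y3) \<ominus> (a \<oplus> b \<oplus> c) \<otimes> y3" using sc y by algebra
    thus ?thesis using y by (simp add: ry sum)
  qed
  \<comment> \<open>By \<open>inverse_diff\<close> this is relation 2 divided by the unit
    \<open>\<ominus> y3\<close>.\<close>
  have 3: "a \<otimes> (x1 \<ominus> x3) \<otimes> y1 \<oplus> b \<otimes> (x2 \<ominus> x3) \<otimes> y2 = \<zero>"
  proof -
    have "(a \<otimes> (x1 \<ominus> x3) \<otimes> y1 \<oplus> b \<otimes> (x2 \<ominus> x3) \<otimes> y2) \<otimes> y3 =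
       \<ominus> (a \<otimes> (\<ominus> ((x1 \<ominus> x3) \<otimes> y1 \<otimes> y3)) \<oplus> b \<otimes> (\<ominus> ((x2 \<ominus> x3) \<otimes> y2 \<otimes> y3)))"
      using sc x y by algebra
    also have "\<dots> = \<zero>"
      unfolding inverse_diff[OF x(1) y(1) x(3) y(3) xy(1,3), symmetric]
        inverse_diff[OF x(2) y(2) x(3) y(3) xy(2,3), symmetric] 2 by simp
    finally show ?thesis using sc x y xy(3) by (subst (asm) integral_iff) auto
  qed
  have "a \<otimes> (x1 \<ominus> x3) \<otimes> (y1 \<ominus> y2) = 
    (a \<otimes> (x1 \<ominus> x3) \<otimes> y1 \<oplus> b \<otimes> (x2 \<ominus> x3) \<otimes> y2) \<ominus> (a \<otimes> (x1 \<ominus> x3) \<oplus> b \<otimes> (x2 \<ominus> x3)) \<otimes> y2"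
    using sc x y by algebra
  also have "\<dots> = \<zero>" unfolding 1 3 using y by algebra
  finally have z: "a \<otimes> (x1 \<ominus> x3) \<otimes> (y1 \<ominus> y2) = \<zero>" .
  have "y1 \<noteq> y2" using inv_unique' xy x y d by (metis m_comm)
  with z show ?thesis using sc x y d by (simp add: integral_iff)
qed

text \<open>If one coefficient vanished, the other three would form a relation on three of the
  points, and \<open>triple_independent\<close>, applied in each order, would make them vanish
  too.\<close>

lemma quadruple_coeffs_nonzero:
  assumes s: "a1 \<in> S" "a2 \<in> S" "a3 \<in> S" "a4 \<in> S"
    and x: "x1 \<in> carrier R" "x2 \<in> carrier R" "x3 \<in> carrier R" "x4 \<in> carrier R"
    and y: "y1 \<in> carrier R" "y2 \<in> carrier R" "y3 \<in> carrier R" "y4 \<in> carrier R"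
    and xy: "x1 \<otimes> y1 = \<one>" "x2 \<otimes> y2 = \<one>" "x3 \<otimes> y3 = \<one>" "x4 \<otimes> y4 = \<one>"
    and T1: "T x1 = \<one>" "T x2 = \<one>" "T x3 = \<one>" "T x4 = \<one>"
    and d: "distinct [x1, x2, x3, x4]"
    and rx: "a1 \<otimes> x1 \<oplus> a2 \<otimes> x2 \<oplus> a3 \<otimes> x3 \<oplus> a4 \<otimes> x4 = \<zero>"
    and ry: "a1 \<otimes> y1 \<oplus> a2 \<otimes> y2 \<oplus> a3 \<otimes> y3 \<oplus> a4 \<otimes> y4 = \<zero>"
    and nz: "\<not> (a1 = \<zero> \<and> a2 = \<zero> \<and> a3 = \<zero> \<and> a4 = \<zero>)"
  shows "a1 \<noteq> \<zero>" "a2 \<noteq> \<zero>" "a3 \<noteq> \<zero>" "a4 \<noteq> \<zero>"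
proof -
  have all: "a = \<zero> \<and> b = \<zero> \<and> c = \<zero>"
    if "a \<in> S" "b \<in> S" "c \<in> S"
      "u1 \<in> carrier R" "u2 \<in> carrier R" "u3 \<in> carrier R"
      "v1 \<in> carrier R" "v2 \<in> carrier R" "v3 \<in> carrier R"
      "u1 \<otimes> v1 = \<one>" "u2 \<otimes> v2 = \<one>" "u3 \<otimes> v3 = \<one>"
      "T u1 = \<one>" "T u2 = \<one>" "T u3 = \<one>" "distinct [u1, u2, u3]"
      "a \<otimes> u1 \<oplus> b \<otimes> u2 \<oplus> c \<otimes> u3 = \<zero>" "a \<otimes> v1 \<oplus> b \<otimes> v2 \<oplus> c \<otimes> v3 = \<zero>"
    for a b c u1 u2 u3 v1 v2 v3
  proof -
    have "a = \<zero>"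
      by (rule triple_independent[of a b c u1 u2 u3 v1 v2 v3]) (use that in auto)
    moreover have "b = \<zero>"
      by (rule triple_independent[of b a c u2 u1 u3 v2 v1 v3]) (use that in \<open>auto simp: a_ac\<close>)
    moreover have "c = \<zero>"
      by (rule triple_independent[of c a b u3 u1 u2 v3 v1 v2]) (use that in \<open>auto simp: a_ac\<close>)
    ultimately show ?thesis by simp
  qed
  show "a1 \<noteq> \<zero>"
  proof
    assume "a1 = \<zero>"
    moreover from this have "a2 = \<zero> \<and> a3 = \<zero> \<and> a4 = \<zero>"
      by (intro all[of _ _ _ x2 x3 x4 y2 y3 y4]) (use assms in auto)
    ultimately show False using nz by simp
  qed
  show "a2 \<noteq> \<zero>"
  proof
    assume "a2 = \<zero>"
    moreover from this have "a1 = \<zero> \<and> a3 = \<zero> \<and> a4 = \<zero>"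
      by (intro all[of _ _ _ x1 x3 x4 y1 y3 y4]) (use assms in auto)
    ultimately show False using nz by simp
  qed
  show "a3 \<noteq> \<zero>"
  proof
    assume "a3 = \<zero>"
    moreover from this have "a1 = \<zero> \<and> a2 = \<zero> \<and> a4 = \<zero>"
      by (intro all[of _ _ _ x1 x2 x4 y1 y2 y4]) (use assms in auto)
    ultimately show False using nz by simp
  qed
  show "a4 \<noteq> \<zero>"
  proof
    assume "a4 = \<zero>"
    moreover from this have "a1 = \<zero> \<and> a2 = \<zero> \<and> a3 = \<zero>"
      by (intro all[of _ _ _ x1 x2 x3 y1 y2 y3]) (use assms in auto)
    ultimately show False using nz by simp
  qed
qed

text \<open>The two relations share the indices 1, 2, 3. They produce a quadratic over
  \<open>S\<close> with distinct roots \<open>z\<close> and \<open>w\<close>, and two evaluations of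
  \<open>T\<close> then show that its discriminant vanishes.\<close>

lemma quintuple_rank:
  assumes l: "l1 \<in> S" "l2 \<in> S" "l3 \<in> S" "l4 \<in> S" "l1 \<noteq> \<zero>" "l2 \<noteq> \<zero>" "l3 \<noteq> \<zero>" "l4 \<noteq> \<zero>"
    and m: "m1 \<in> S" "m2 \<in> S" "m3 \<in> S" "m5 \<in> S" "m1 \<noteq> \<zero>" "m2 \<noteq> \<zero>" "m3 \<noteq> \<zero>" "m5 \<noteq> \<zero>"
    and x: "x1 \<in> carrier R" "x2 \<in> carrier R" "x3 \<in> carrier R" "x4 \<in> carrier R" "x5 \<in> carrier R"
    and y: "y1 \<in> carrier R" "y2 \<in> carrier R" "y3 \<in> carrier R" "y4 \<in> carrier R" "y5 \<in> carrier R"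
    and xy: "x1 \<otimes> y1 = \<one>" "x2 \<otimes> y2 = \<one>" "x3 \<otimes> y3 = \<one>" "x4 \<otimes> y4 = \<one>" "x5 \<otimes> y5 = \<one>"
    and T1: "T x1 = \<one>" "T x2 = \<one>" "T x3 = \<one>" "T x4 = \<one>" "T x5 = \<one>"
    and d: "x2 \<noteq> x3" "x1 \<noteq> x5" "x4 \<noteq> x5"
    and lx: "l1 \<otimes> x1 \<oplus> l2 \<otimes> x2 \<oplus> l3 \<otimes> x3 \<oplus> l4 \<otimes> x4 = \<zero>"
    and ly: "l1 \<otimes> y1 \<oplus> l2 \<otimes> y2 \<oplus> l3 \<otimes> y3 \<oplus> l4 \<otimes> y4 = \<zero>"
    and mx: "m1 \<otimes> x1 \<oplus> m2 \<otimes> x2 \<oplus> m3 \<otimes> x3 \<oplus> m5 \<otimes> x5 = \<zero>"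
    and my: "m1 \<otimes> y1 \<oplus> m2 \<otimes> y2 \<oplus> m3 \<otimes> y3 \<oplus> m5 \<otimes> y5 = \<zero>"
  shows False
proof -
  have lc: "l1 \<in> carrier R" "l2 \<in> carrier R" "l3 \<in> carrier R" "l4 \<in> carrier R"
    and mc: "m1 \<in> carrier R" "m2 \<in> carrier R" "m3 \<in> carrier R" "m5 \<in> carrier R"
    using l m by auto
  have ls: "l1 \<oplus> l2 \<oplus> l3 \<oplus> l4 = \<zero>"
    using arg_cong[OF lx, of T] l x by (simp add: T1)
  have ms: "m1 \<oplus> m2 \<oplus> m3 \<oplus> m5 = \<zero>"
    using arg_cong[OF mx, of T] m x by (simp add: T1)
  \<comment> \<open>The coefficient sum is zero, so subtracting that multiple of \<open>u\<close>
    removes the fourth term.\<close>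
  have shift: "a \<otimes> (u1 \<ominus> u) \<oplus> b \<otimes> (u2 \<ominus> u) \<oplus> c \<otimes> (u3 \<ominus> u) = \<zero>"
    if "a \<oplus> b \<oplus> c \<oplus> e = \<zero>" "a \<otimes> u1 \<oplus> b \<otimes> u2 \<oplus> c \<otimes> u3 \<oplus> e \<otimes> u = \<zero>"
      and car: "a \<in> carrier R" "b \<in> carrier R" "c \<in> carrier R" "e \<in> carrier R"
        "u1 \<in> carrier R" "u2 \<in> carrier R" "u3 \<in> carrier R" "u \<in> carrier R"
    for a b c e u1 u2 u3 u
  proof -
    have "a \<otimes> (u1 \<ominus> u) \<oplus> b \<otimes> (u2 \<ominus> u) \<oplus> c \<otimes> (u3 \<ominus> u) =
       (a \<otimes> u1 \<oplus> b \<otimes> u2 \<oplus> c \<otimes> u3 \<oplus> e \<otimes> u) \<ominus> (a \<oplus> b \<oplus> c \<oplus> e) \<otimes> u"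
      using car by algebra
    thus ?thesis using car by (simp add: that)
  qed
  have lx': "l1 \<otimes> (x1 \<ominus> x4) \<oplus> l2 \<otimes> (x2 \<ominus> x4) \<oplus> l3 \<otimes> (x3 \<ominus> x4) = \<zero>"
    by (rule shift[OF ls lx]) (use lc x in auto)
  have ly': "l1 \<otimes> (y1 \<ominus> y4) \<oplus> l2 \<otimes> (y2 \<ominus> y4) \<oplus> l3 \<otimes> (y3 \<ominus> y4) = \<zero>"
    by (rule shift[OF ls ly]) (use lc y in auto)
  have mx': "m1 \<otimes> (x1 \<ominus> x5) \<oplus> m2 \<otimes> (x2 \<ominus> x5) \<oplus> m3 \<otimes> (x3 \<ominus> x5) = \<zero>"
    by (rule shift[OF ms mx]) (use mc x in auto)
  have my': "m1 \<otimes> (y1 \<ominus> y5) \<oplus> m2 \<otimes> (y2 \<ominus> y5) \<oplus> m3 \<otimes> (y3 \<ominus> y5) = \<zero>"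
    by (rule shift[OF ms my]) (use mc y in auto)
  \<comment> \<open>The shifted relation between the inverses, divided by
    \<open>\<ominus> v\<close>: the weights \<open>a \<otimes> (x1 \<ominus> u)\<close> and so on
    are orthogonal to \<open>(y1, y2, y3)\<close>, as well as to \<open>(1, 1, 1)\<close>.\<close>
  have weight: "a \<otimes> (x1 \<ominus> u) \<otimes> y1 \<oplus> b \<otimes> (x2 \<ominus> u) \<otimes> y2 \<oplus> c \<otimes> (x3 \<ominus> u) \<otimes> y3 = \<zero>"
    if eq: "a \<otimes> (y1 \<ominus> v) \<oplus> b \<otimes> (y2 \<ominus> v) \<oplus> c \<otimes> (y3 \<ominus> v) = \<zero>" and uv: "u \<otimes> v = \<one>"
      and car: "a \<in> carrier R" "b \<in> carrier R" "c \<in> carrier R" "u \<in> carrier R" "v \<in> carrier R"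
    for a b c u v
  proof -
    have "(a \<otimes> (x1 \<ominus> u) \<otimes> y1 \<oplus> b \<otimes> (x2 \<ominus> u) \<otimes> y2 \<oplus> c \<otimes> (x3 \<ominus> u) \<otimes> y3) \<otimes> v =
      \<ominus> (a \<otimes> (\<ominus> ((x1 \<ominus> u) \<otimes> y1 \<otimes> v)) \<oplus> b \<otimes> (\<ominus> ((x2 \<ominus> u) \<otimes> y2 \<otimes> v)) \<oplus> c \<otimes> (\<ominus> ((x3 \<ominus> u) \<otimes> y3 \<otimes> v)))"
      using car x y by algebra
    also have "\<dots> = \<zero>"
      unfolding inverse_diff[OF x(1) y(1) car(4,5) xy(1) uv, symmetric]
        inverse_diff[OF x(2) y(2) car(4,5) xy(2) uv, symmetric]
        inverse_diff[OF x(3) y(3) car(4,5) xy(3) uv, symmetric] eq by simp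
    finally show ?thesis using car x y uv by (subst (asm) integral_iff) auto
  qed
  have y23: "y2 \<noteq> y3" using inv_unique' xy x y d by (metis m_comm)
  obtain z where z: "z \<in> carrier R" and E: "l1 \<otimes> (x1 \<ominus> x4) = z \<otimes> (m1 \<otimes> (x1 \<ominus> x5))"
      "l2 \<otimes> (x2 \<ominus> x4) = z \<otimes> (m2 \<otimes> (x2 \<ominus> x5))" "l3 \<otimes> (x3 \<ominus> x4) = z \<otimes> (m3 \<otimes> (x3 \<ominus> x5))"
    by (rule kernel_pair_proportional[OF _ _ _ _ _ _ y(1-3) lx' weight[OF ly' xy(4)] mx' weight[OF my' xy(5)] y23])
      (use lc mc x y m d in \<open>auto simp: integral_iff\<close>)
  \<comment> \<open>The factor that replaces \<open>z\<close> when every \<open>x\<close> is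
    exchanged with its inverse \<open>y\<close>; \<open>E'\<close> verifies this.\<close>
  define w where "w = z \<otimes> x5 \<otimes> y4"
  have w: "w \<in> carrier R" using z x y by (simp add: w_def)
  have wx: "w \<otimes> x4 = z \<otimes> x5"
  proof -
    have "w \<otimes> x4 = z \<otimes> x5 \<otimes> (x4 \<otimes> y4)" unfolding w_def using z x y by algebra
    thus ?thesis using xy z x by simp
  qed
  have E': "l \<otimes> (v \<ominus> y4) = w \<otimes> (m \<otimes> (v \<ominus> y5))"
    if E: "l \<otimes> (u \<ominus> x4) = z \<otimes> (m \<otimes> (u \<ominus> x5))" and uv: "u \<otimes> v = \<one>"
      and car: "l \<in> carrier R" "m \<in> carrier R" "u \<in> carrier R" "v \<in> carrier R" for l m u v
  proof -
    have "l \<otimes> (v \<ominus> y4) = \<ominus> (l \<otimes> (u \<ominus> x4)) \<otimes> v \<otimes> y4"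
      unfolding inverse_diff[OF car(3,4) x(4) y(4) uv xy(4)] using car x y by algebra
    also have "\<dots> = \<ominus> (z \<otimes> (m \<otimes> (u \<ominus> x5)) \<otimes> v \<otimes> y4) \<otimes> (x5 \<otimes> y5)"
      unfolding E xy using car x y z by algebra
    also have "\<dots> = w \<otimes> (m \<otimes> (\<ominus> ((u \<ominus> x5) \<otimes> v \<otimes> y5)))"
      unfolding w_def using car x y z by algebra
    finally show ?thesis unfolding inverse_diff[OF car(3,4) x(5) y(5) uv xy(5)] .
  qed
  \<comment> \<open>Rearranges the proportionality into the form that
    \<open>three_cross_terms\<close> expects, with \<open>d = a \<ominus> b\<close>.\<close>
  have e: "(l \<ominus> m \<otimes> t) \<otimes> (u \<ominus> b) = l \<otimes> (a \<ominus> b)"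
    if "l \<otimes> (u \<ominus> a) = t \<otimes> (m \<otimes> (u \<ominus> b))" 
      and car: "l \<in> carrier R" "m \<in> carrier R" "u \<in> carrier R" "t \<in> carrier R" "a \<in> carrier R" "b \<in> carrier R"
    for l m u t a b
  proof -
    have "(l \<ominus> m \<otimes> t) \<otimes> (u \<ominus> b) = l \<otimes> (u \<ominus> b) \<ominus> t \<otimes> (m \<otimes> (u \<ominus> b))"
      using car by algebra
    also have "\<dots> = l \<otimes> (a \<ominus> b)" unfolding that(1)[symmetric] using car by algebra
    finally show ?thesis .
  qed
  have y45: "y4 \<noteq> y5" using inv_unique' xy x y d by (metis m_comm)
  \<comment> \<open>These coefficients do not involve the points, so the data in \<open>x\<close>
    and the data in \<open>y\<close> give one and the same quadratic, with roots \<open>z\<close>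
    and \<open>w\<close>. \<open>A\<close> is nonzero because
    \<open>l1 \<oplus> l2 \<oplus> l3 = \<ominus> l4\<close>.\<close>
  define A where "A = m1 \<otimes> m2 \<otimes> m3 \<otimes> (l1 \<oplus> l2 \<oplus> l3)"
  define B where "B = m1 \<otimes> l1 \<otimes> (l2 \<otimes> m3 \<oplus> m2 \<otimes> l3) \<oplus> m2 \<otimes> l2 \<otimes> (l1 \<otimes> m3 \<oplus> m1 \<otimes> l3) \<oplus> m3 \<otimes> l3 \<otimes> (l1 \<otimes> m2 \<oplus> m1 \<otimes> l2)"
  define C where "C = l1 \<otimes> l2 \<otimes> l3 \<otimes> (m1 \<oplus> m2 \<oplus> m3)"
  have ABC: "A \<in> S" "B \<in> S" "C \<in> S" using l m by (auto simp: A_def B_def C_def)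
  have ABCc: "A \<in> carrier R" "B \<in> carrier R" "C \<in> carrier R" using ABC by auto
  have "l1 \<oplus> l2 \<oplus> l3 \<noteq> \<zero>" using ls lc l(8) by auto
  hence A0: "A \<noteq> \<zero>" using lc mc m by (auto simp: A_def integral_iff)
  have Pz: "A \<otimes> z \<otimes> z \<ominus> B \<otimes> z \<oplus> C = \<zero>"
    unfolding A_def B_def C_def
    by (rule three_cross_terms[where d = "x4 \<ominus> x5", OF _ _ _ _ _ _ _ _ _ _ _ e[OF E(1)] e[OF E(2)] e[OF E(3)] mx'])
      (use lc mc x z d in auto)
  have Pw: "A \<otimes> w \<otimes> w \<ominus> B \<otimes> w \<oplus> C = \<zero>"
    unfolding A_def B_def C_def
    by (rule three_cross_terms[where d = "y4 \<ominus> y5", OF _ _ _ _ _ _ _ _ _ _ _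
          e[OF E'[OF E(1) xy(1)]] e[OF E'[OF E(2) xy(2)]] e[OF E'[OF E(3) xy(3)]] my'])
      (use lc mc x y w y45 in auto)
  \<comment> \<open>Equality would force \<open>z = \<zero>\<close> by \<open>wx\<close>, hence
    \<open>C = \<zero>\<close>; but \<open>m1 \<oplus> m2 \<oplus> m3 = \<ominus> m5\<close> is
    nonzero.\<close>
  have zw: "z \<noteq> w"
  proof
    assume "z = w"
    hence "z \<otimes> (x4 \<ominus> x5) = \<zero>" using wx z x by (simp add: r_distr a_minus_def r_minus r_neg)
    hence "z = \<zero>" using z x d by (simp add: integral_iff)
    hence "C = \<zero>" using Pz ABCc by (simp add: a_minus_def)
    moreover have "m1 \<oplus> m2 \<oplus> m3 \<noteq> \<zero>" using ms mc m(8) by auto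
    ultimately show False using lc mc l by (auto simp: C_def integral_iff)
  qed
  \<comment> \<open>By Vieta, \<open>A \<otimes> s\<close> and \<open>A \<otimes> p\<close> lie in
    \<open>S\<close>, where \<open>A\<close> is invertible. Hence \<open>T\<close> can pull out
    \<open>s\<close> and \<open>p\<close>.\<close>
  define s p where "s = z \<oplus> w" and "p = z \<otimes> w"
  have sp: "A \<otimes> s = B" "A \<otimes> p = C"
    using quadratic_Vieta[OF ABCc z w Pz Pw zw] by (auto simp: s_def p_def)
  have spc: "s \<in> carrier R" "p \<in> carrier R" using z w by (auto simp: s_def p_def)
  have divA: "t \<in> S" if "A \<otimes> t \<in> S" "t \<in> carrier R" for t
  proof -
    have "t = inv A \<otimes> (A \<otimes> t)" using that A0 ABCc by (simp add: m_assoc[symmetric] field_Units)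
    also have "\<dots> \<in> S" using that A0 ABC by auto
    finally show ?thesis .
  qed
  have spS: "s \<in> S" "p \<in> S" using divA[of s] divA[of p] sp spc ABC by simp_all
  \<comment> \<open>Both expressions for \<open>k\<close> matter: they give
    \<open>z \<otimes> k = p \<otimes> x4\<close> and \<open>w \<otimes> k = p \<otimes> x5\<close>,
    so \<open>T\<close> of the sum yields \<open>s \<otimes> t = p \<oplus> p\<close>.\<close>
  define k where "k = w \<otimes> x4"
  have k: "k \<in> carrier R" "k = z \<otimes> x5" using w x z wx by (auto simp: k_def)
  define t where "t = T k"
  have t: "t \<in> carrier R" using k(1) by (simp add: t_def)
  have "s \<otimes> k = z \<otimes> k \<oplus> w \<otimes> k" using z w k(1) by (simp add: s_def l_distr)
  also have "z \<otimes> k = p \<otimes> x4" using z w x by (simp add: k_def p_def m_assoc)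
  also have "w \<otimes> k = p \<otimes> x5" unfolding k(2) p_def using z w x by algebra
  finally have "T (s \<otimes> k) = T (p \<otimes> x4 \<oplus> p \<otimes> x5)" by simp
  hence st: "s \<otimes> t = p \<oplus> p" using k(1) x spS spc by (simp add: t_def T1)
  have "s = t \<oplus> t"
  proof -
    define f where "f = l1 \<ominus> m1 \<otimes> w"
    have f: "f \<in> carrier R" using lc mc w by (simp add: f_def)
    have 1: "x1 \<otimes> (l1 \<ominus> m1 \<otimes> z) = x4 \<otimes> f"
    proof -
      have "x1 \<otimes> (l1 \<ominus> m1 \<otimes> z) = l1 \<otimes> (x1 \<ominus> x4) \<ominus> z \<otimes> (m1 \<otimes> (x1 \<ominus> x5)) \<oplus> (l1 \<otimes> x4 \<ominus> m1 \<otimes> (z \<otimes> x5))"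
        using lc mc z x by algebra
      also have "\<dots> = l1 \<otimes> x4 \<ominus> m1 \<otimes> (w \<otimes> x4)" unfolding E(1) wx using lc mc z x by algebra
      also have "\<dots> = x4 \<otimes> f" unfolding f_def using lc mc w x by algebra
      finally show ?thesis .
    qed
    \<comment> \<open>\<open>M\<close> is \<open>(l1 \<ominus> m1 \<otimes> z) \<otimes> (l1
      \<ominus> m1 \<otimes> w)\<close>, an element of \<open>S\<close>. By equation 1,
      \<open>M \<otimes> x1 = x4 \<otimes> f \<otimes> f\<close>, which expands into an
      \<open>S\<close>-combination of \<open>x4\<close>, \<open>k\<close> and \<open>x5\<close>;
      \<open>T\<close> evaluates both sides.\<close>
    define M where "M = l1 \<otimes> l1 \<ominus> l1 \<otimes> m1 \<otimes> s \<oplus> m1 \<otimes> m1 \<otimes> p"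
    have M: "M \<in> S" using l m spS by (simp add: M_def a_minus_def)
    have "M \<otimes> x1 = (x1 \<otimes> (l1 \<ominus> m1 \<otimes> z)) \<otimes> f"
      unfolding M_def f_def s_def p_def using lc mc z w x by algebra
    also have "\<dots> = l1 \<otimes> l1 \<otimes> x4 \<oplus> \<ominus> (l1 \<otimes> m1) \<otimes> (w \<otimes> x4) \<oplus> \<ominus> (l1 \<otimes> m1) \<otimes> (w \<otimes> x4) \<oplus> m1 \<otimes> m1 \<otimes> (w \<otimes> (w \<otimes> x4))"
      unfolding 1 f_def using lc mc w x by algebra
    also have "\<dots> = l1 \<otimes> l1 \<otimes> x4 \<oplus> \<ominus> (l1 \<otimes> m1) \<otimes> k \<oplus> \<ominus> (l1 \<otimes> m1) \<otimes> k \<oplus> m1 \<otimes> m1 \<otimes> p \<otimes> x5"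
    proof -
      have "m1 \<otimes> m1 \<otimes> (w \<otimes> (w \<otimes> x4)) = m1 \<otimes> m1 \<otimes> p \<otimes> x5"
        unfolding wx p_def using mc z w x by algebra
      thus ?thesis by (simp add: k_def)
    qed
    finally have "T (M \<otimes> x1) = T (l1 \<otimes> l1 \<otimes> x4 \<oplus> \<ominus> (l1 \<otimes> m1) \<otimes> k \<oplus> \<ominus> (l1 \<otimes> m1) \<otimes> k \<oplus> m1 \<otimes> m1 \<otimes> p \<otimes> x5)"
      by simp
    hence "M = l1 \<otimes> l1 \<oplus> \<ominus> (l1 \<otimes> m1) \<otimes> t \<oplus> \<ominus> (l1 \<otimes> m1) \<otimes> t \<oplus> m1 \<otimes> m1 \<otimes> p"
      using M l m x k(1) lc mc spS by (simp add: T1 t_def)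
    moreover have "l1 \<otimes> m1 \<otimes> (s \<ominus> (t \<oplus> t)) = l1 \<otimes> l1 \<oplus> \<ominus> (l1 \<otimes> m1) \<otimes> t \<oplus> \<ominus> (l1 \<otimes> m1) \<otimes> t \<oplus> m1 \<otimes> m1 \<otimes> p \<ominus> M"
      unfolding M_def using lc mc spc t by algebra
    ultimately have "l1 \<otimes> m1 \<otimes> (s \<ominus> (t \<oplus> t)) = \<zero>" using S_carrier[OF M] by (simp add: r_right_minus_eq)
    thus ?thesis using lc mc spc t l m by (simp add: integral_iff)
  qed
  hence "s \<otimes> s = (s \<otimes> t) \<oplus> (s \<otimes> t)" using spc t by (simp add: r_distr)
  hence ss: "s \<otimes> s = (p \<oplus> p) \<oplus> (p \<oplus> p)" by (simp add: st)
  \<comment> \<open>The discriminant; writing it as a square covers characteristic two as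
    well.\<close>
  have "(z \<ominus> w) \<otimes> (z \<ominus> w) = s \<otimes> s \<ominus> ((p \<oplus> p) \<oplus> (p \<oplus> p))"
    unfolding s_def p_def using z w by algebra
  hence "(z \<ominus> w) \<otimes> (z \<ominus> w) = \<zero>" using ss spc by simp
  thus False using z w zw by (simp add: integral_iff)
qed

end

section \<open>Embedding a finite field into a larger one\<close>

context cring
begin

text \<open>Integer coefficients make sense in every ring, so one polynomial can be evaluated both
  in the small and in the large field before any map between them is known.\<close>

definition int_eval :: "int poly \<Rightarrow> 'a \<Rightarrow> 'a" where
  "int_eval f x = fold_coeffs (\<lambda>c r. [c] \<cdot> \<one> \<oplus> x \<otimes> r) f \<zero>"

lemma int_eval_0 [simp]: "int_eval 0 x = \<zero>"
  by (simp add: int_eval_def)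

lemma int_eval_pCons [simp]:
  assumes "x \<in> carrier R"
  shows "int_eval (pCons c f) x = [c] \<cdot> \<one> \<oplus> x \<otimes> int_eval f x"
proof (cases "c = 0 \<and> f = 0")
  case True
  with assms show ?thesis by (simp add: int_eval_def add_pow_def)
next
  case False
  then show ?thesis by (auto simp: int_eval_def)
qed

lemma int_eval_closed [simp]: "x \<in> carrier R \<Longrightarrow> int_eval f x \<in> carrier R"
  by (induction f) auto

lemma int_embed_add: "[(a + b :: int)] \<cdot> \<one> = [a] \<cdot> \<one> \<oplus> [b] \<cdot> \<one>"
  by (simp add: add.int_pow_mult)

lemma int_embed_mult: "[(a * b :: int)] \<cdot> \<one> = [a] \<cdot> \<one> \<otimes> [b] \<cdot> \<one>"
  by (simp add: add_pow_ldistr_int add_pow_rdistr_int add.int_pow_pow mult.commute)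

lemma int_embed_0 [simp]: "[(0 :: int)] \<cdot> \<one> = \<zero>"
  by (simp add: add_pow_def)

lemma int_eval_add:
  assumes "x \<in> carrier R"
  shows "int_eval (f + g) x = int_eval f x \<oplus> int_eval g x"
proof (induction f g rule: poly_induct2)
  case (pCons a p b q)
  have "[a] \<cdot> \<one> \<in> carrier R" "[b] \<cdot> \<one> \<in> carrier R" "int_eval p x \<in> carrier R" "int_eval q x \<in> carrier R"
    using assms by auto
  thus ?case using assms by (simp add: pCons int_embed_add r_distr a_ac)
qed simp

lemma int_eval_smult:
  assumes "x \<in> carrier R"
  shows "int_eval (smult c f) x = [c] \<cdot> \<one> \<otimes> int_eval f x"
  using assms by (induction f) (auto simp: int_embed_mult r_distr m_lcomm)

lemma int_eval_mult:
  assumes "x \<in> carrier R"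
  shows "int_eval (f * g) x = int_eval f x \<otimes> int_eval g x"
proof (induction f)
  case (pCons a p)
  have "[a] \<cdot> \<one> \<in> carrier R" by simp
  thus ?case using assms by (simp add: pCons int_eval_add int_eval_smult l_distr m_assoc)
qed (use assms in simp)

lemma int_eval_diff:
  assumes "x \<in> carrier R"
  shows "int_eval (f - g) x = int_eval f x \<ominus> int_eval g x"
  using int_eval_add[OF assms, of "f - g" g] assms
  by (simp add: a_minus_def a_assoc r_neg)

lemma int_eval_1 [simp]: "x \<in> carrier R \<Longrightarrow> int_eval 1 x = \<one>"
  unfolding one_pCons by simp

lemma int_eval_monom [simp]: "x \<in> carrier R \<Longrightarrow> int_eval (Polynomial.monom 1 n) x = x [^] n"
proof (induction n)
  case (Suc n)
  then show ?case by (simp add: monom_Suc m_comm)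
qed (simp add: monom_0)

text \<open>With \<open>c\<close> the characteristic, this allows integer polynomials to be handled
  modulo \<open>p\<close>.\<close>

lemma int_eval_coeffs_dvd:
  assumes "x \<in> carrier R" "[c] \<cdot> \<one> = \<zero>" "\<And>i. c dvd Polynomial.coeff f i"
  shows "int_eval f x = \<zero>"
proof -
  have "[:c:] dvd f" using assms by (simp add: const_poly_dvd_iff)
  then obtain g where "f = [:c:] * g" by (elim dvdE)
  thus ?thesis using assms by (simp add: int_eval_smult)
qed

end

section \<open>Counting the roots of a polynomial in a finite domain\<close>

context domain
begin

definition horner :: "'a list \<Rightarrow> 'a \<Rightarrow> 'a" where
  "horner cs x = foldr (\<lambda>c r. c \<oplus> x \<otimes> r) cs \<zero>"

lemma horner_simps [simp]: "horner [] x = \<zero>" "horner (c # cs) x = c \<oplus> x \<otimes> horner cs x"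
  by (simp_all add: horner_def)

lemma horner_closed [simp]: "set cs \<subseteq> carrier R \<Longrightarrow> x \<in> carrier R \<Longrightarrow> horner cs x \<in> carrier R"
  by (induction cs) auto

text \<open>Synthetic division by \<open>X - a\<close>, on coefficient lists with the constant term
  first. The clause on \<open>last\<close> preserves the leading coefficient for the induction in
  \<open>card_horner_roots\<close>.\<close>

lemma horner_factor:
  assumes "set cs \<subseteq> carrier R" "a \<in> carrier R" "cs \<noteq> []"
  shows "\<exists>ds. set ds \<subseteq> carrier R \<and> length cs = Suc (length ds) \<and> (ds \<noteq> [] \<longrightarrow> last ds = last cs) \<and>
    (\<forall>x\<in>carrier R. horner cs x = horner cs a \<oplus> (x \<ominus> a) \<otimes> horner ds x)"
  using assms
proof (induction cs)
  case (Cons c cs)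
  show ?case
  proof (cases "cs = []")
    case True
    with Cons.prems show ?thesis by (intro exI[of _ "[]"]) auto
  next
    case False
    with Cons obtain ds where ds: "set ds \<subseteq> carrier R" "length cs = Suc (length ds)" "ds \<noteq> [] \<longrightarrow> last ds = last cs"
      "\<And>x. x \<in> carrier R \<Longrightarrow> horner cs x = horner cs a \<oplus> (x \<ominus> a) \<otimes> horner ds x"
      by auto
    have last: "last (horner cs a # ds) = last cs"
    proof (cases "ds = []")
      case True
      then obtain d where "cs = [d]" using ds(2) by (auto simp: length_Suc_conv)
      thus ?thesis using True Cons.prems by simp
    qed (use ds in auto)
    \<comment> \<open>Horner's scheme: the value of the tail at \<open>a\<close> becomes the
      constant term of the quotient.\<close>
    have "horner (c # cs) x = horner (c # cs) a \<oplus> (x \<ominus> a) \<otimes> horner (horner cs a # ds) x" if x: "x \<in> carrier R" for x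
    proof -
      have "c \<in> carrier R" "horner cs a \<in> carrier R" "horner ds x \<in> carrier R"
        using Cons.prems ds(1) x by auto
      thus ?thesis using x Cons.prems(2) unfolding horner_simps ds(4)[OF x] by algebra
    qed
    moreover have "set (horner cs a # ds) \<subseteq> carrier R" using Cons.prems ds(1) by auto
    ultimately show ?thesis using ds(2) last False
      by (intro exI[of _ "horner cs a # ds"] conjI ballI) simp_all
  qed
qed simp

text \<open>Any root other than \<open>a\<close> is a root of the quotient by \<open>X - a\<close>,
  as there are no zero divisors. The bound is strict since the length is the degree plus
  one.\<close>

lemma card_horner_roots:
  assumes "finite (carrier R)" "set cs \<subseteq> carrier R" "cs \<noteq> []" "last cs \<noteq> \<zero>"
  shows "card {x \<in> carrier R. horner cs x = \<zero>} < length cs"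
  using assms(2-)
proof (induction "length cs" arbitrary: cs)
  case (Suc n)
  show ?case
  proof (cases "\<exists>a\<in>carrier R. horner cs a = \<zero>")
    case True
    then obtain a where a: "a \<in> carrier R" "horner cs a = \<zero>" by blast
    obtain ds where ds: "set ds \<subseteq> carrier R" "length cs = Suc (length ds)" "ds \<noteq> [] \<longrightarrow> last ds = last cs"
      "\<And>x. x \<in> carrier R \<Longrightarrow> horner cs x = horner cs a \<oplus> (x \<ominus> a) \<otimes> horner ds x"
      using horner_factor[OF Suc.prems(1) a(1) Suc.prems(2)] by blast
    have root: "horner ds x = \<zero>" if "x \<in> carrier R" "horner cs x = \<zero>" "x \<noteq> a" for x
    proof -
      have "(x \<ominus> a) \<otimes> horner ds x = \<zero>" using ds(4)[OF that(1)] ds(1) that(1) a(1) by (simp add: a(2) that(2))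
      thus ?thesis using ds(1) that(1,3) a(1) by (simp add: integral_iff)
    qed
    have "ds \<noteq> []"
    proof
      assume "ds = []"
      then obtain d where "cs = [d]" using ds(2) by (auto simp: length_Suc_conv)
      thus False using a Suc.prems by simp
    qed
    hence IH: "card {x \<in> carrier R. horner ds x = \<zero>} < length ds"
      using Suc.hyps(2) Suc.prems ds(1-3) by (intro Suc.hyps(1)) auto
    have "{x \<in> carrier R. horner cs x = \<zero>} \<subseteq> insert a {x \<in> carrier R. horner ds x = \<zero>}"
      using root by auto
    hence "card {x \<in> carrier R. horner cs x = \<zero>} \<le> card (insert a {x \<in> carrier R. horner ds x = \<zero>})"
      using assms(1) by (intro card_mono) auto
    also have "\<dots> \<le> Suc (card {x \<in> carrier R. horner ds x = \<zero>})" by (simp add: card_insert_if assms(1))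
    finally show ?thesis using IH ds(2) by simp
  next
    case False
    hence "{x \<in> carrier R. horner cs x = \<zero>} = {}" by auto
    thus ?thesis using Suc.prems by (simp only: card.empty) simp
  qed
qed simp

text \<open>Leading coefficient one stays nonzero in \<open>R\<close>, so the degree survives the
  passage from the integers to \<open>R\<close>.\<close>

lemma card_int_roots_le_degree:
  assumes "finite (carrier R)" "lead_coeff f = 1"
  shows "card {x \<in> carrier R. int_eval f x = \<zero>} \<le> degree f"
proof -
  let ?cs = "map (\<lambda>c. [c] \<cdot> \<one>) (coeffs f)"
  have f0: "f \<noteq> 0" using assms by auto
  have "int_eval f x = horner ?cs x" for x
    by (simp add: int_eval_def horner_def fold_coeffs_def foldr_map comp_def)
  moreover have "card {x \<in> carrier R. horner ?cs x = \<zero>} < length ?cs"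
    using f0 assms by (intro card_horner_roots) (auto simp: last_map last_coeffs_eq_coeff_degree)
  ultimately show ?thesis by (simp add: length_coeffs_degree[OF f0])
qed

end

lemma (in field) finite_field_pow_order:
  assumes "finite (carrier R)" "x \<in> carrier R"
  shows "x [^] order R = x"
proof (cases "x = \<zero>")
  case True
  have "order R \<noteq> 0" using assms by (auto simp: Coset.order_def)
  with True show ?thesis by (simp add: nat_pow_zero)
next
  case False
  interpret G: group "mult_of R" by (rule field_mult_group)
  have "order R \<noteq> 0" using assms by (auto simp: Coset.order_def)
  then obtain n where n: "order R = Suc n" by (cases "order R") auto
  \<comment> \<open>Lagrange's theorem in the multiplicative group, which has
    \<open>n = order R - 1\<close> elements.\<close>
  have "x [^] n = \<one>"
    using G.pow_order_eq_1[of x] assms False n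
    by (simp add: order_mult_of nat_pow_mult_of)
  thus ?thesis using assms n by simp
qed

text \<open>The order of the additive group annihilates \<open>\<one>\<close>, so the image of
  \<open>p\<close> is nilpotent, and a field has no nonzero nilpotents.\<close>

lemma (in field) int_embed_char_prime_power:
  assumes "order R = p ^ k" 
  shows "[int p] \<cdot> \<one> = \<zero>"
proof -
  have "[order R] \<cdot> \<one> = \<zero>"
    using add.pow_order_eq_1[of \<one>] by (simp add: Coset.order_def add_pow_def)
  hence "[int (p ^ k)] \<cdot> \<one> = \<zero>" by (simp add: assms add_pow_int_ge del: of_nat_power)
  moreover have "[int (p ^ k)] \<cdot> \<one> = ([int p] \<cdot> \<one>) [^] k" for k
    by (induction k) (simp_all add: int_embed_mult m_comm)
  moreover have "x = \<zero>" if "x \<in> carrier R" "x [^] k = \<zero>" for x and k :: nat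
    using that by (induction k) (auto simp: integral_iff)
  ultimately show ?thesis by (metis add.int_pow_closed one_closed)
qed

text \<open>Every element of \<open>F\<close> is the value of an integer polynomial at a generator
  \<open>g\<close>. If all polynomials vanishing at \<open>g\<close> also vanish at some
  \<open>z\<close> in \<open>K\<close>, then sending the value at \<open>g\<close> to the value at
  \<open>z\<close> is a homomorphism.\<close>

lemma finite_field_embedding:
  fixes F :: "('a, 'b) ring_scheme" and K :: "('c, 'd) ring_scheme"
  assumes "field F" "field K" and q: "primepow q" and oF: "order F = q" and oK: "order K = q ^ m" and m: "m > 0"
  obtains h where "h \<in> ring_hom F K"
proof -
  interpret F: field F by fact
  interpret K: field K by fact
  obtain p k where p: "prime p" "q = p ^ k" using q by (auto simp: primepow_def)
  have q1: "q > 1" using q by (simp add: primepow_gt_Suc_0)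
  have finF: "finite (carrier F)" using oF q1 by (auto simp: Coset.order_def intro: card_ge_0_finite)
  have finK: "finite (carrier K)" using oK q1 by (auto simp: Coset.order_def intro: card_ge_0_finite)
  have pF: "add_pow F (int p) \<one>\<^bsub>F\<^esub> = \<zero>\<^bsub>F\<^esub>"
    by (rule F.int_embed_char_prime_power) (simp add: oF p)
  have pK: "add_pow K (int p) \<one>\<^bsub>K\<^esub> = \<zero>\<^bsub>K\<^esub>"
    by (rule K.int_embed_char_prime_power[of _ "k * m"]) (simp add: oK p power_mult)
  obtain g where g: "g \<in> carrier F" and gen: "carrier F - {\<zero>\<^bsub>F\<^esub>} = {g [^]\<^bsub>F\<^esub> i | i::nat. i \<in> UNIV}"
    using F.finite_field_mult_group_has_gen[OF finF] by auto
  define J where "J = {f. F.int_eval f g = \<zero>\<^bsub>F\<^esub>}"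
  have J_diff: "f1 - f2 \<in> J" if "f1 \<in> J" "f2 \<in> J" for f1 f2
    using that g by (simp add: J_def F.int_eval_diff)
  have J_mult: "f1 * f2 \<in> J" if "f1 \<in> J" for f1 f2
    using that g by (simp add: J_def F.int_eval_mult)
  have J_dvd: "f \<in> J" if "\<And>i. int p dvd coeff f i" for f
    using F.int_eval_coeffs_dvd[OF g pF that] by (simp add: J_def)
  let ?U = "Polynomial.monom 1 (q ^ m) - Polynomial.monom 1 1 :: int poly"
  have qm1: "q ^ m > 1" using q1 m by (intro one_less_power)
  have Udeg: "degree ?U = q ^ m"
    using qm1 degree_add_eq_left[of "- Polynomial.monom 1 1 :: int poly" "Polynomial.monom 1 (q ^ m)"]
    by (simp add: degree_monom_eq)
  have Umonic: "lead_coeff ?U = 1" unfolding Udeg using qm1 by simp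
  \<comment> \<open>Iterated Frobenius; the case \<open>i = m\<close> puts \<open>?U\<close>, that
    is \<open>X^N - X\<close>, into \<open>J\<close>.\<close>
  have "g [^]\<^bsub>F\<^esub> (q ^ i) = g" for i :: nat
    using F.finite_field_pow_order[OF finF g] g
    by (induction i) (simp_all add: oF F.nat_pow_pow[symmetric])
  hence UJ: "?U \<in> J" using g by (simp add: J_def F.int_eval_diff)
  obtain f where f: "f \<in> J" "lead_coeff f = 1" and
      f_min: "\<And>f'. f' \<in> J \<Longrightarrow> lead_coeff f' = 1 \<Longrightarrow> degree f \<le> degree f'"
    using ex_has_least_nat[of "\<lambda>f. f \<in> J \<and> lead_coeff f = 1" ?U degree] UJ Umonic by blast
  \<comment> \<open>\<open>f\<close> lifts the minimal polynomial of \<open>g\<close> over the prime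
    field; below its degree, \<open>J\<close> contains only polynomials that are zero modulo
    \<open>p\<close>.\<close>
  have small: "int p dvd coeff r i"
    if "r \<in> J" "r = 0 \<or> degree r < degree f" for r i
    using that
  \<comment> \<open>The number of coefficients drops even when removing the leading term of a
    constant leaves zero; the degree would not.\<close>
  proof (induction "length (coeffs r)" arbitrary: r rule: less_induct)
    case less
    show ?case
    proof (cases "r = 0")
      case False
      let ?c = "lead_coeff r"
      have "int p dvd ?c"
      proof (rule ccontr)
        assume "\<not> int p dvd ?c"
        hence "coprime (int p) ?c" using p by (simp add: prime_imp_coprime)
        then obtain u v where uv: "u * int p + v * ?c = 1"
          using bezout_int[of "int p" ?c] by auto
        \<comment> \<open>Bezout makes the leading coefficient one while staying in
          \<open>J\<close>, which contradicts the minimality of \<open>f\<close>.\<close>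
        let ?w = "smult v r + Polynomial.monom (u * int p) (degree r)"
        have "?w = [:v:] * r - Polynomial.monom (- (u * int p)) (degree r)"
          by (simp add: minus_monom)
        also have "\<dots> \<in> J"
        proof (rule J_diff)
          show "[:v:] * r \<in> J" using J_mult[OF less.prems(1), of "[:v:]"] by (simp add: mult.commute)
          show "Polynomial.monom (- (u * int p)) (degree r) \<in> J" by (rule J_dvd) (simp add: coeff_monom)
        qed
        finally have "?w \<in> J" .
        moreover have top: "coeff ?w (degree r) = 1"
          by (simp add: uv[symmetric])
        moreover have "degree ?w \<le> degree r"
          by (rule degree_add_le[OF degree_smult_le degree_monom_le])
        hence "degree ?w = degree r"
          using top le_degree[of ?w "degree r"] by (metis le_antisym zero_neq_one)
        ultimately have "degree f \<le> degree r"
          using f_min[of ?w] by metis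
        with less.prems False show False by auto
      qed
      define r' where "r' = r - Polynomial.monom ?c (degree r)"
      have "r' \<in> J" unfolding r'_def
        by (rule J_diff[OF less.prems(1) J_dvd]) (use \<open>int p dvd ?c\<close> in \<open>auto simp add: coeff_monom\<close>)
      moreover have "length (coeffs r') < length (coeffs r)"
      proof (cases "r' = 0")
        case r'0: False
        have "degree r' \<le> degree r"
          unfolding r'_def by (rule degree_diff_le[OF order_refl degree_monom_le])
        moreover have "coeff r' (degree r) = 0" by (simp add: r'_def)
        ultimately have "degree r' < degree r"
          using r'0 by (metis leading_coeff_0_iff le_neq_implies_less)
        thus ?thesis using r'0 False by (simp add: length_coeffs)
      qed (use False in \<open>simp add: length_coeffs\<close>)
      moreover have "r' = 0 \<or> degree r' < degree f"
        using less.prems False calculation(2) by (cases "r' = 0") (auto simp: length_coeffs)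
      ultimately have "int p dvd coeff r' i" by (intro less.hyps)
      hence "int p dvd coeff r' i + coeff (Polynomial.monom ?c (degree r)) i"
        using \<open>int p dvd ?c\<close> by (auto simp: coeff_monom)
      thus ?thesis by (simp add: r'_def)
    qed simp
  qed
  have f0: "f \<noteq> 0" using f by auto
  \<comment> \<open>Pseudo-division scales \<open>v\<close> by a power of the leading coefficient of
    \<open>f\<close>, which is one.\<close>
  have division: "\<exists>a r. v = f * a + r \<and> (r = 0 \<or> degree r < degree f)" for v
  proof -
    obtain a r where ar: "pseudo_divmod v f = (a, r)" by fastforce
    show ?thesis using pseudo_divmod[OF f0 ar] f by auto
  qed
  \<comment> \<open>The remainder lies in \<open>J\<close> and is zero or has small degree, so by
    \<open>small\<close> it evaluates to zero throughout \<open>K\<close>.\<close>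
  have divisionJ: "\<exists>a r. v = f * a + r \<and> (r = 0 \<or> degree r < degree f) \<and>
      (\<forall>x \<in> carrier K. K.int_eval v x = K.int_eval f x \<otimes>\<^bsub>K\<^esub> K.int_eval a x)" if v: "v \<in> J" for v
  proof -
    obtain a r where ar: "v = f * a + r" "r = 0 \<or> degree r < degree f"
      using division by blast
    have "r = v - f * a" using ar by simp
    hence "r \<in> J" using J_diff[OF v J_mult[OF f(1)]] by simp
    hence "K.int_eval r x = \<zero>\<^bsub>K\<^esub>" if "x \<in> carrier K" for x
      using small ar(2) that by (intro K.int_eval_coeffs_dvd[OF _ pK]) auto
    thus ?thesis using ar by (intro exI[of _ a] exI[of _ r]) (auto simp: K.int_eval_add K.int_eval_mult)
  qed
  have f_deg: "degree f > 0"
  proof (rule ccontr)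
    assume "\<not> ?thesis"
    then obtain c where "f = [:c:]" using degree_0_id[of f] by (metis neq0_conv)
    hence "f = 1" using f by (auto simp: one_pCons)
    thus False using f g by (simp add: J_def)
  qed
  \<comment> \<open>\<open>X\<^sup>N - X\<close> vanishes on all \<open>N = q\<^sup>m\<close> elements of \<open>K\<close>, and its cofactor of \<open>f\<close> has too small a degree to do so\<close>
  obtain z where z: "z \<in> carrier K" "K.int_eval f z = \<zero>\<^bsub>K\<^esub>"
  proof -
    obtain a r where ar: "?U = f * a + r" "r = 0 \<or> degree r < degree f"
      and ev: "\<And>x. x \<in> carrier K \<Longrightarrow> K.int_eval ?U x = K.int_eval f x \<otimes>\<^bsub>K\<^esub> K.int_eval a x"
      using divisionJ[OF UJ] by blast
    have df: "degree f \<le> q ^ m" using f_min[OF UJ Umonic] Udeg by simp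
    have fa: "f * a = ?U - r" using ar by (simp add: algebra_simps)
    \<comment> \<open>The remainder does not reach degree \<open>q ^ m\<close>, so
      \<open>f * a\<close> inherits the leading term of \<open>?U\<close> and \<open>a\<close> is
      monic.\<close>
    have c: "coeff (f * a) (q ^ m) = 1"
      unfolding fa using ar(2) df Umonic Udeg by (auto simp: coeff_eq_0)
    have "degree (f * a) \<le> q ^ m"
      unfolding fa by (rule degree_diff_le) (use ar(2) df Udeg in auto)
    with c have "degree (f * a) = q ^ m"
      by (metis le_degree le_antisym zero_neq_one)
    moreover from this c have am: "lead_coeff a = 1" and a0: "a \<noteq> 0"
      using f lead_coeff_mult[of f a] by auto
    ultimately have "degree f + degree a = q ^ m"
      using degree_mult_eq[OF f0 a0] by simp
    hence "card {x \<in> carrier K. K.int_eval a x = \<zero>\<^bsub>K\<^esub>} < card (carrier K)"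
      using K.card_int_roots_le_degree[OF finK am] f_deg oK by (simp add: Coset.order_def)
    hence "{x \<in> carrier K. K.int_eval a x = \<zero>\<^bsub>K\<^esub>} \<noteq> carrier K" by auto
    then obtain z where z: "z \<in> carrier K" "K.int_eval a z \<noteq> \<zero>\<^bsub>K\<^esub>" by auto
    have "K.int_eval ?U z = \<zero>\<^bsub>K\<^esub>"
      using K.finite_field_pow_order[OF finK z(1)] z by (simp add: K.int_eval_diff oK)
    with ev[OF z(1)] z have "K.int_eval f z = \<zero>\<^bsub>K\<^esub>" by (simp add: K.integral_iff)
    with z that show thesis by blast
  qed
  have Jz: "K.int_eval v z = \<zero>\<^bsub>K\<^esub>" if "v \<in> J" for v
    using divisionJ[OF that] z by auto
  have surj: "\<exists>v. F.int_eval v g = x" if "x \<in> carrier F" for x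
  proof (cases "x = \<zero>\<^bsub>F\<^esub>")
    case True
    then show ?thesis by (intro exI[of _ 0]) simp
  next
    case False
    with that gen obtain i where "x = g [^]\<^bsub>F\<^esub> (i::nat)" by blast
    then show ?thesis using g by (intro exI[of _ "Polynomial.monom 1 i"]) simp
  qed
  \<comment> \<open>The choice of \<open>v\<close> does not matter: two candidates differ by an
    element of \<open>J\<close>, which vanishes at \<open>z\<close> by \<open>Jz\<close>.\<close>
  define h where "h x = K.int_eval (SOME v. F.int_eval v g = x) z" for x
  have h: "h (F.int_eval v g) = K.int_eval v z" for v
  proof -
    let ?v = "SOME u. F.int_eval u g = F.int_eval v g"
    have "F.int_eval ?v g = F.int_eval v g" by (rule someI[of _ v]) simp
    hence "?v - v \<in> J" using g by (simp add: J_def F.int_eval_diff)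
    from Jz[OF this] show ?thesis using z by (simp add: h_def K.int_eval_diff)
  qed
  have "h \<in> ring_hom F K"
  proof (rule ring_hom_memI)
    fix x assume "x \<in> carrier F"
    thus "h x \<in> carrier K" using z by (simp add: h_def)
  next
    fix x y assume xy: "x \<in> carrier F" "y \<in> carrier F"
    obtain v w where [simp]: "x = F.int_eval v g" "y = F.int_eval w g" using surj xy by metis
    show "h (x \<otimes>\<^bsub>F\<^esub> y) = h x \<otimes>\<^bsub>K\<^esub> h y"
      using h[of "v * w"] g z by (simp add: F.int_eval_mult K.int_eval_mult h)
    show "h (x \<oplus>\<^bsub>F\<^esub> y) = h x \<oplus>\<^bsub>K\<^esub> h y"
      using h[of "v + w"] g z by (simp add: F.int_eval_add K.int_eval_add h)
  next
    show "h \<one>\<^bsub>F\<^esub> = \<one>\<^bsub>K\<^esub>" using h[of 1] g z by simp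
  qed
  thus thesis by (rule that)
qed

section \<open>The point set\<close>

text \<open>Through \<open>h\<close>, \<open>K\<close> is a vector space over \<open>F\<close>. A
  basis is built greedily: combinations of \<open>k < m\<close> vectors cannot fill
  \<open>K\<close>, and \<open>m\<close> independent vectors fill it by counting.\<close>

lemma finite_field_extension_coordinates:
  fixes F :: "('a, 'b) ring_scheme" and K :: "('c, 'd) ring_scheme"
  assumes "field F" "field K" and h: "h \<in> ring_hom F K"
    and finF: "finite (carrier F)" and oK: "order K = order F ^ m"
  obtains L where "bij_betw L ({..<m} \<rightarrow>\<^sub>E carrier F) (carrier K)"
    and "\<And>c d. c \<in> {..<m} \<rightarrow>\<^sub>E carrier F \<Longrightarrow> d \<in> {..<m} \<rightarrow>\<^sub>E carrier F \<Longrightarrow>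
           L (\<lambda>i\<in>{..<m}. c i \<oplus>\<^bsub>F\<^esub> d i) = L c \<oplus>\<^bsub>K\<^esub> L d"
    and "\<And>a c. a \<in> carrier F \<Longrightarrow> c \<in> {..<m} \<rightarrow>\<^sub>E carrier F \<Longrightarrow>
           L (\<lambda>i\<in>{..<m}. a \<otimes>\<^bsub>F\<^esub> c i) = h a \<otimes>\<^bsub>K\<^esub> L c"
proof -
  interpret F: field F by fact
  interpret K: field K by fact
  interpret h: ring_hom_cring F K h by (unfold_locales) (rule h)
  define L where "L b k c = (\<Oplus>\<^bsub>K\<^esub>i\<in>{..<k}. h (c i) \<otimes>\<^bsub>K\<^esub> b i)" for b :: "nat \<Rightarrow> 'c" and k c
  have L_closed: "L b k c \<in> carrier K" if "b \<in> UNIV \<rightarrow> carrier K" "c \<in> {..<k} \<rightarrow> carrier F" for b k c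
    unfolding L_def using that by (intro K.finsum_closed) auto
  have L_add: "L b k (\<lambda>i\<in>{..<k}. c i \<oplus>\<^bsub>F\<^esub> d i) = L b k c \<oplus>\<^bsub>K\<^esub> L b k d"
    if "b \<in> UNIV \<rightarrow> carrier K" "c \<in> {..<k} \<rightarrow> carrier F" "d \<in> {..<k} \<rightarrow> carrier F" for b k c d
  proof -
    have "L b k (\<lambda>i\<in>{..<k}. c i \<oplus>\<^bsub>F\<^esub> d i) = (\<Oplus>\<^bsub>K\<^esub>i\<in>{..<k}. h (c i) \<otimes>\<^bsub>K\<^esub> b i \<oplus>\<^bsub>K\<^esub> h (d i) \<otimes>\<^bsub>K\<^esub> b i)"
      unfolding L_def using that by (intro K.finsum_cong') (auto simp: Pi_iff K.l_distr)
    also have "\<dots> = L b k c \<oplus>\<^bsub>K\<^esub> L b k d"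
      unfolding L_def using that by (intro K.finsum_addf) (auto simp: Pi_iff)
    finally show ?thesis .
  qed
  have L_smult: "L b k (\<lambda>i\<in>{..<k}. a \<otimes>\<^bsub>F\<^esub> c i) = h a \<otimes>\<^bsub>K\<^esub> L b k c"
    if "b \<in> UNIV \<rightarrow> carrier K" "c \<in> {..<k} \<rightarrow> carrier F" "a \<in> carrier F" for b k a c
  proof -
    have "L b k (\<lambda>i\<in>{..<k}. a \<otimes>\<^bsub>F\<^esub> c i) = (\<Oplus>\<^bsub>K\<^esub>i\<in>{..<k}. h a \<otimes>\<^bsub>K\<^esub> (h (c i) \<otimes>\<^bsub>K\<^esub> b i))"
      unfolding L_def using that by (intro K.finsum_cong') (auto simp: Pi_iff K.m_assoc)
    also have "\<dots> = h a \<otimes>\<^bsub>K\<^esub> L b k c"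
      unfolding L_def using that by (intro K.finsum_rdistr[symmetric]) (auto simp: Pi_iff)
    finally show ?thesis .
  qed
  have "card (carrier F) > 1"
    using finF F.zero_not_one card_mono[OF finF, of "{\<zero>\<^bsub>F\<^esub>, \<one>\<^bsub>F\<^esub>}"] by simp
  hence oF: "order F > 1" by (simp add: Coset.order_def)
  have finK: "finite (carrier K)"
    using oK oF by (intro card_ge_0_finite) (simp add: Coset.order_def)
  have ex: "\<exists>b. b \<in> UNIV \<rightarrow> carrier K \<and>
      (\<forall>c \<in> {..<k} \<rightarrow> carrier F. L b k c = \<zero>\<^bsub>K\<^esub> \<longrightarrow> (\<forall>i<k. c i = \<zero>\<^bsub>F\<^esub>))" if "k \<le> m" for k
    using that
  proof (induction k)
    case 0
    show ?case by (intro exI[of _ "\<lambda>_. \<zero>\<^bsub>K\<^esub>"]) auto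
  next
    case (Suc k)
    then obtain b where b: "b \<in> UNIV \<rightarrow> carrier K"
      and ind: "\<And>c. c \<in> {..<k} \<rightarrow> carrier F \<Longrightarrow> L b k c = \<zero>\<^bsub>K\<^esub> \<Longrightarrow> \<forall>i<k. c i = \<zero>\<^bsub>F\<^esub>"
      by auto
    have "card (L b k ` ({..<k} \<rightarrow>\<^sub>E carrier F)) \<le> card ({..<k} \<rightarrow>\<^sub>E carrier F)"
      using finF by (intro card_image_le finite_PiE) auto
    also have "\<dots> = order F ^ k" by (simp add: card_PiE Coset.order_def)
    also have "\<dots> < order F ^ m" using Suc.prems oF by (intro power_strict_increasing) auto
    also have "\<dots> = card (carrier K)" using oK by (simp add: Coset.order_def)
    finally have "L b k ` ({..<k} \<rightarrow>\<^sub>E carrier F) \<noteq> carrier K" by auto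
    moreover have "L b k ` ({..<k} \<rightarrow>\<^sub>E carrier F) \<subseteq> carrier K"
      using b by (auto intro!: L_closed)
    ultimately obtain e where e: "e \<in> carrier K" "e \<notin> L b k ` ({..<k} \<rightarrow>\<^sub>E carrier F)" by blast
    have "\<forall>i<Suc k. c i = \<zero>\<^bsub>F\<^esub>" if c: "c \<in> {..<Suc k} \<rightarrow> carrier F" and 0: "L (b(k := e)) (Suc k) c = \<zero>\<^bsub>K\<^esub>" for c
    proof -
      have ck: "c k \<in> carrier F" and c': "c \<in> {..<k} \<rightarrow> carrier F" using c by auto
      have "L (b(k := e)) (Suc k) c = h (c k) \<otimes>\<^bsub>K\<^esub> e \<oplus>\<^bsub>K\<^esub> L b k c"
      proof -
        have "L (b(k := e)) (Suc k) c = h (c k) \<otimes>\<^bsub>K\<^esub> e \<oplus>\<^bsub>K\<^esub> L (b(k := e)) k c"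
          unfolding L_def lessThan_Suc using b c e by (subst K.finsum_insert) (auto simp: Pi_iff)
        also have "L (b(k := e)) k c = L b k c"
          unfolding L_def using b c' by (intro K.finsum_cong') (auto simp: Pi_iff)
        finally show ?thesis .
      qed
      with 0 have eq: "h (c k) \<otimes>\<^bsub>K\<^esub> e \<oplus>\<^bsub>K\<^esub> L b k c = \<zero>\<^bsub>K\<^esub>" by simp
      have Lc: "L b k c \<in> carrier K" using b c' by (rule L_closed)
      \<comment> \<open>Otherwise \<open>e\<close> could be solved for and would be a combination of
        the first \<open>k\<close> vectors.\<close>
      have "c k = \<zero>\<^bsub>F\<^esub>"
      proof (rule ccontr)
        assume nz: "c k \<noteq> \<zero>\<^bsub>F\<^esub>"
        define a where "a = inv\<^bsub>F\<^esub> (c k)"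
        have a: "a \<in> carrier F" "a \<otimes>\<^bsub>F\<^esub> c k = \<one>\<^bsub>F\<^esub>"
          using nz ck by (auto simp: a_def F.field_Units)
        have "h a \<otimes>\<^bsub>K\<^esub> h (c k) = \<one>\<^bsub>K\<^esub>" using a ck h.hom_mult[of a "c k"] by simp
        hence "e = h a \<otimes>\<^bsub>K\<^esub> (h (c k) \<otimes>\<^bsub>K\<^esub> e)" using a ck e by (simp add: K.m_assoc[symmetric])
        also have "h (c k) \<otimes>\<^bsub>K\<^esub> e = \<ominus>\<^bsub>K\<^esub> L b k c"
          using eq Lc ck e by (intro K.minus_equality[symmetric]) auto
        also have "h a \<otimes>\<^bsub>K\<^esub> \<ominus>\<^bsub>K\<^esub> L b k c = h (\<ominus>\<^bsub>F\<^esub> a) \<otimes>\<^bsub>K\<^esub> L b k c"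
          using a Lc by (simp add: K.r_minus K.l_minus)
        also have "\<dots> = L b k (\<lambda>i\<in>{..<k}. \<ominus>\<^bsub>F\<^esub> a \<otimes>\<^bsub>F\<^esub> c i)"
          using a b c' by (intro L_smult[symmetric]) auto
        also have "\<dots> \<in> L b k ` ({..<k} \<rightarrow>\<^sub>E carrier F)"
          using a c' by (intro imageI restrict_PiE_iff[THEN iffD2]) (auto simp: Pi_iff)
        finally show False using e by simp
      qed
      moreover from this have "L b k c = \<zero>\<^bsub>K\<^esub>" using eq e Lc by simp
      hence "\<forall>i<k. c i = \<zero>\<^bsub>F\<^esub>" using ind c' by blast
      ultimately show ?thesis by (auto simp: less_Suc_eq)
    qed
    moreover have "b(k := e) \<in> UNIV \<rightarrow> carrier K" using b e by auto
    ultimately show ?case by blast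
  qed
  from ex[OF order_refl] obtain b where b: "b \<in> UNIV \<rightarrow> carrier K"
    and ind: "\<And>c. c \<in> {..<m} \<rightarrow> carrier F \<Longrightarrow> L b m c = \<zero>\<^bsub>K\<^esub> \<Longrightarrow> \<forall>i<m. c i = \<zero>\<^bsub>F\<^esub>"
    by blast
  have inj: "inj_on (L b m) ({..<m} \<rightarrow>\<^sub>E carrier F)"
  proof (rule inj_onI)
    fix c d assume cd: "c \<in> {..<m} \<rightarrow>\<^sub>E carrier F" "d \<in> {..<m} \<rightarrow>\<^sub>E carrier F" "L b m c = L b m d"
    have c: "c \<in> {..<m} \<rightarrow> carrier F" and d: "d \<in> {..<m} \<rightarrow> carrier F" using cd by auto
    \<comment> \<open>The negative of \<open>d\<close>, written as a scalar multiple so that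
      \<open>L_add\<close> and \<open>L_smult\<close> give the difference of the two values.\<close>
    define d' where "d' = (\<lambda>i\<in>{..<m}. \<ominus>\<^bsub>F\<^esub> \<one>\<^bsub>F\<^esub> \<otimes>\<^bsub>F\<^esub> d i)"
    have d': "d' \<in> {..<m} \<rightarrow> carrier F" using d by (auto simp: d'_def)
    have "L b m (\<lambda>i\<in>{..<m}. c i \<oplus>\<^bsub>F\<^esub> d' i) = L b m c \<oplus>\<^bsub>K\<^esub> h (\<ominus>\<^bsub>F\<^esub> \<one>\<^bsub>F\<^esub>) \<otimes>\<^bsub>K\<^esub> L b m d"
      unfolding L_add[OF b c d'] unfolding d'_def using L_smult[OF b d] by simp
    also have "\<dots> = \<zero>\<^bsub>K\<^esub>"
      using cd(3) L_closed[OF b d] by (simp add: K.l_minus K.r_neg)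
    finally have "\<forall>i<m. (\<lambda>i\<in>{..<m}. c i \<oplus>\<^bsub>F\<^esub> d' i) i = \<zero>\<^bsub>F\<^esub>"
      by (rule ind[rotated]) (use c d' in \<open>auto simp: Pi_iff\<close>)
    hence "c i \<ominus>\<^bsub>F\<^esub> d i = \<zero>\<^bsub>F\<^esub>" if "i < m" for i
      using that c d by (auto simp: d'_def Pi_iff F.l_minus a_minus_def)
    hence "c i = d i" if "i < m" for i
      using that c d by (auto simp: Pi_iff)
    thus "c = d" using cd by (intro PiE_ext) auto
  qed
  have "L b m ` ({..<m} \<rightarrow>\<^sub>E carrier F) = carrier K"
  proof (rule card_subset_eq[OF finK])
    show "L b m ` ({..<m} \<rightarrow>\<^sub>E carrier F) \<subseteq> carrier K" using b by (auto intro!: L_closed)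
    show "card (L b m ` ({..<m} \<rightarrow>\<^sub>E carrier F)) = card (carrier K)"
      using oK by (simp add: card_image[OF inj] card_PiE Coset.order_def)
  qed
  with inj have "bij_betw (L b m) ({..<m} \<rightarrow>\<^sub>E carrier F) (carrier K)" by (simp add: bij_betw_def)
  thus thesis using b by (intro that[of "L b m"]) (auto intro!: L_add L_smult)
qed

section \<open>Dimension and linear dependence in subspaces\<close>

context vectorspace
begin

lemma dim_span_singleton:
  assumes "v \<in> carrier V" "v \<noteq> \<zero>\<^bsub>V\<^esub>"
  shows "vectorspace.dim K (vs (span {v})) = 1"
proof -
  have sub: "VectorSpace.subspace K (span {v}) V" using assms by (intro span_is_subspace) auto
  interpret W: vectorspace K "vs (span {v})" by (rule subspace_is_vs[OF sub])
  have "W.span {v} = span {v}"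
    using span_self[OF assms(1)] is_module[OF sub] by (intro span_li_not_depend) auto
  thus ?thesis using assms span_self[OF assms(1)] by (intro W.dim1I) auto
qed

text \<open>A finite subspace generates itself, hence is finite-dimensional, and its dimension
  bounds the size of its independent subsets. Dependence then carries over to
  \<open>V\<close>.\<close>

lemma lin_dep_in_finite_subspace:
  assumes sub: "VectorSpace.subspace K W V" and fin: "finite W"
    and A: "A \<subseteq> W" "card A > vectorspace.dim K (vs W)"
  shows "lin_dep A"
proof -
  interpret W: vectorspace K "vs W" by (rule subspace_is_vs[OF sub])
  have "W.gen_set W" using W.in_own_span[of W] W.span_is_subset2[of W] by auto
  hence "W.fin_dim" using fin by (auto simp: W.fin_dim_def)
  hence "W.lin_dep A" using W.li_le_dim(2)[of A] A by fastforce
  thus ?thesis using span_li_not_depend(2)[OF A(1) is_module[OF sub]] by simp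
qed

lemma lin_dep_quadruple:
  assumes v: "v1 \<in> carrier V" "v2 \<in> carrier V" "v3 \<in> carrier V" "v4 \<in> carrier V"
    and d: "distinct [v1, v2, v3, v4]" and "lin_dep {v1, v2, v3, v4}"
  obtains a1 a2 a3 a4 where "a1 \<in> carrier K" "a2 \<in> carrier K" "a3 \<in> carrier K" "a4 \<in> carrier K"
    and "\<not> (a1 = \<zero>\<^bsub>K\<^esub> \<and> a2 = \<zero>\<^bsub>K\<^esub> \<and> a3 = \<zero>\<^bsub>K\<^esub> \<and> a4 = \<zero>\<^bsub>K\<^esub>)"
    and "a1 \<odot>\<^bsub>V\<^esub> v1 \<oplus>\<^bsub>V\<^esub> a2 \<odot>\<^bsub>V\<^esub> v2 \<oplus>\<^bsub>V\<^esub> a3 \<odot>\<^bsub>V\<^esub> v3 \<oplus>\<^bsub>V\<^esub> a4 \<odot>\<^bsub>V\<^esub> v4 = \<zero>\<^bsub>V\<^esub>"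
proof -
  obtain a v where a: "a \<in> {v1, v2, v3, v4} \<rightarrow> carrier K" "lincomb a {v1, v2, v3, v4} = \<zero>\<^bsub>V\<^esub>"
      "v \<in> {v1, v2, v3, v4}" "a v \<noteq> \<zero>\<^bsub>K\<^esub>"
    using finite_lin_dep[of "{v1, v2, v3, v4}"] assms by auto
  have "lincomb a {v1, v2, v3, v4} =
      a v1 \<odot>\<^bsub>V\<^esub> v1 \<oplus>\<^bsub>V\<^esub> a v2 \<odot>\<^bsub>V\<^esub> v2 \<oplus>\<^bsub>V\<^esub> a v3 \<odot>\<^bsub>V\<^esub> v3 \<oplus>\<^bsub>V\<^esub> a v4 \<odot>\<^bsub>V\<^esub> v4"
    unfolding lincomb_def using a(1) v d by (simp add: M.finsum_insert M.a_assoc)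
  with a show thesis by (intro that[of "a v1" "a v2" "a v3" "a v4"]) auto
qed

end


lemma card_ge_5_distinct:
  assumes "card A \<ge> 5"
  obtains x1 x2 x3 x4 x5 where "{x1, x2, x3, x4, x5} \<subseteq> A" "distinct [x1, x2, x3, x4, x5]"
proof -
  obtain B where B: "B \<subseteq> A" "card B = 5" using assms by (meson obtain_subset_with_card_n)
  then obtain xs where xs: "set xs = B" "distinct xs"
    using finite_distinct_list[of B] card.infinite[of B] by fastforce
  with B have len: "length xs = 5" by (metis distinct_card)
  then obtain x1 x2 x3 x4 x5 where "xs = [x1, x2, x3, x4, x5]"
    by (auto simp: numeral_eq_Suc length_Suc_conv)
  with xs B show thesis by (intro that[of x1 x2 x3 x4 x5]) auto
qed

text \<open>Since \<open>n + 1 = 2 * m\<close>, the coordinates split into two halves, each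
  identified with \<open>K\<close>. Fixing coordinate 0 as one leaves \<open>m - 1\<close> free
  coordinates in the first half; the second half is forced to be its inverse.\<close>

lemma four_two_set_from_extension:
  fixes F :: "('a, 'b) ring_scheme" and K :: "('c, 'd) ring_scheme"
  assumes "field F" "field K" and h: "h \<in> ring_hom F K"
    and finF: "finite (carrier F)" and oK: "order K = order F ^ m" and m: "m > 0" and n: "n = 2 * m - 1"
  shows "\<exists>X. four_two_set F n X \<and> card X = order F ^ (m - 1)"
proof -
  interpret F: field F by fact
  interpret K: field K by fact
  interpret h: ring_hom_ring F K h by (intro ring_hom_ringI2 F.ring_axioms K.ring_axioms h)
  have h0: "a = \<zero>\<^bsub>F\<^esub>" if "a \<in> carrier F" "h a = \<zero>\<^bsub>K\<^esub>" for a
  proof (rule ccontr)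
    assume "a \<noteq> \<zero>\<^bsub>F\<^esub>"
    hence "inv\<^bsub>F\<^esub> a \<in> carrier F" "a \<otimes>\<^bsub>F\<^esub> inv\<^bsub>F\<^esub> a = \<one>\<^bsub>F\<^esub>" using that by (auto simp: F.field_Units)
    thus False using h.hom_mult[of a "inv\<^bsub>F\<^esub> a"] that by simp
  qed
  let ?A = "{..<m} \<rightarrow>\<^sub>E carrier F"
  obtain L where L: "bij_betw L ?A (carrier K)"
    and L_add: "\<And>c d. c \<in> ?A \<Longrightarrow> d \<in> ?A \<Longrightarrow> L (\<lambda>i\<in>{..<m}. c i \<oplus>\<^bsub>F\<^esub> d i) = L c \<oplus>\<^bsub>K\<^esub> L d"
    and L_smult: "\<And>a c. a \<in> carrier F \<Longrightarrow> c \<in> ?A \<Longrightarrow> L (\<lambda>i\<in>{..<m}. a \<otimes>\<^bsub>F\<^esub> c i) = h a \<otimes>\<^bsub>K\<^esub> L c"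
    using finite_field_extension_coordinates[OF \<open>field F\<close> \<open>field K\<close> h finF oK] by blast
  have L_closed: "L c \<in> carrier K" if "c \<in> ?A" for c using L that by (auto simp: bij_betw_def)
  have L_surj: "\<exists>c\<in>?A. t = L c" if "t \<in> carrier K" for t using L that by (auto simp: bij_betw_def)
  define V where "V = coord_space F n"
  interpret V: vectorspace F V
    unfolding V_def coord_space_def vectorspace_def
    by (intro conjI F.func_space_is_module \<open>field F\<close>)
  have carV: "carrier V = {0..n} \<rightarrow>\<^sub>E carrier F"
    and addV: "v \<oplus>\<^bsub>V\<^esub> w = (\<lambda>i\<in>{0..n}. v i \<oplus>\<^bsub>F\<^esub> w i)"
    and smultV: "a \<odot>\<^bsub>V\<^esub> v = (\<lambda>i\<in>{0..n}. a \<otimes>\<^bsub>F\<^esub> v i)"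
    and zeroV: "\<zero>\<^bsub>V\<^esub> = (\<lambda>i\<in>{0..n}. \<zero>\<^bsub>F\<^esub>)" for v w a
    by (simp_all add: V_def coord_space_def F.func_space_def)
  define lo hi where "lo v = (\<lambda>i\<in>{..<m}. v i)" and "hi v = (\<lambda>i\<in>{..<m}. v (m + i))" for v :: "nat \<Rightarrow> 'a"
  define x y where "x v = L (lo v)" and "y v = L (hi v)" for v
  have lohi: "lo v \<in> ?A" "hi v \<in> ?A" if "v \<in> carrier V" for v
    using that m n by (auto simp: carV lo_def hi_def PiE_iff)
  have xy_closed [simp]: "x v \<in> carrier K" "y v \<in> carrier K" if "v \<in> carrier V" for v
    using that by (auto simp: x_def y_def intro!: L_closed lohi)
  have xy_add: "x (v \<oplus>\<^bsub>V\<^esub> w) = x v \<oplus>\<^bsub>K\<^esub> x w" "y (v \<oplus>\<^bsub>V\<^esub> w) = y v \<oplus>\<^bsub>K\<^esub> y w"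
    if "v \<in> carrier V" "w \<in> carrier V" for v w
  proof -
    have "lo (v \<oplus>\<^bsub>V\<^esub> w) = (\<lambda>i\<in>{..<m}. lo v i \<oplus>\<^bsub>F\<^esub> lo w i)" "hi (v \<oplus>\<^bsub>V\<^esub> w) = (\<lambda>i\<in>{..<m}. hi v i \<oplus>\<^bsub>F\<^esub> hi w i)"
      using m n by (auto simp: lo_def hi_def addV restrict_def fun_eq_iff)
    thus "x (v \<oplus>\<^bsub>V\<^esub> w) = x v \<oplus>\<^bsub>K\<^esub> x w" "y (v \<oplus>\<^bsub>V\<^esub> w) = y v \<oplus>\<^bsub>K\<^esub> y w"
      using lohi that by (auto simp: x_def y_def L_add)
  qed
  have xy_smult: "x (a \<odot>\<^bsub>V\<^esub> v) = h a \<otimes>\<^bsub>K\<^esub> x v" "y (a \<odot>\<^bsub>V\<^esub> v) = h a \<otimes>\<^bsub>K\<^esub> y v"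
    if "a \<in> carrier F" "v \<in> carrier V" for a v
  proof -
    have "lo (a \<odot>\<^bsub>V\<^esub> v) = (\<lambda>i\<in>{..<m}. a \<otimes>\<^bsub>F\<^esub> lo v i)" "hi (a \<odot>\<^bsub>V\<^esub> v) = (\<lambda>i\<in>{..<m}. a \<otimes>\<^bsub>F\<^esub> hi v i)"
      using m n by (auto simp: lo_def hi_def smultV restrict_def fun_eq_iff)
    thus "x (a \<odot>\<^bsub>V\<^esub> v) = h a \<otimes>\<^bsub>K\<^esub> x v" "y (a \<odot>\<^bsub>V\<^esub> v) = h a \<otimes>\<^bsub>K\<^esub> y v"
      using lohi that by (auto simp: x_def y_def L_smult)
  qed
  have xy_zero: "x \<zero>\<^bsub>V\<^esub> = \<zero>\<^bsub>K\<^esub>" "y \<zero>\<^bsub>V\<^esub> = \<zero>\<^bsub>K\<^esub>"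
    using xy_smult[of "\<zero>\<^bsub>F\<^esub>" "\<zero>\<^bsub>V\<^esub>"] by auto
  have xy_inj: "v = w" if "v \<in> carrier V" "w \<in> carrier V" "x v = x w" "y v = y w" for v w
  proof (rule PiE_ext)
    show "v \<in> {0..n} \<rightarrow>\<^sub>E carrier F" "w \<in> {0..n} \<rightarrow>\<^sub>E carrier F" using that by (auto simp: carV)
    have eq: "lo v = lo w" "hi v = hi w"
      using that lohi L by (auto simp: x_def y_def bij_betw_def inj_on_def)
    fix i assume i: "i \<in> {0..n}"
    show "v i = w i"
    proof (cases "i < m")
      case True
      thus ?thesis using fun_cong[OF eq(1), of i] by (simp add: lo_def)
    next
      case False
      hence "i - m < m" using i n m by simp
      thus ?thesis using fun_cong[OF eq(2), of "i - m"] False by (simp add: hi_def)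
    qed
  qed
  have xy_surj: "\<exists>v \<in> carrier V. lo v = c \<and> y v = t" if c: "c \<in> ?A" and t: "t \<in> carrier K" for c t
  proof -
    obtain d where d: "d \<in> ?A" "t = L d" using L_surj t by blast
    let ?v = "\<lambda>i\<in>{0..n}. if i < m then c i else d (i - m)"
    have "lo ?v = c" "hi ?v = d" using c d m n
      by (auto simp: lo_def hi_def fun_eq_iff PiE_iff extensional_def)
    moreover have "?v \<in> carrier V" using c d m n by (auto simp: carV PiE_iff)
    ultimately show ?thesis using d by (intro bexI[of _ ?v]) (auto simp: y_def)
  qed
  \<comment> \<open>The nonzero linear form: coordinate 0 with respect to the basis behind
    \<open>L\<close>, viewed inside \<open>K\<close>.\<close>
  define T where "T t = h (inv_into ?A L t 0)" for t
  have TL: "T (L c) = h (c 0)" if "c \<in> ?A" for c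
    using L that by (simp add: T_def bij_betw_def inv_into_f_f)
  have Tx: "T (x v) = h (v 0)" if "v \<in> carrier V" for v
    using TL[OF lohi(1)[OF that]] m by (simp add: x_def lo_def)
  have A0: "c 0 \<in> carrier F" if "c \<in> ?A" for c using that m by (auto simp: PiE_iff)
  interpret subfield_linear_map K "h ` carrier F" T
  proof (intro subfield_linear_map.intro subfield_linear_map_axioms.intro)
    show "field K" by fact
    show "subfield (h ` carrier F) K"
      using h.img_is_subfield(2)[OF F.carrier_is_subfield] by simp
  next
    show "T t \<in> carrier K" if t: "t \<in> carrier K" for t
    proof -
      obtain c where c: "c \<in> ?A" "t = L c" using L_surj[OF t] by blast
      show ?thesis unfolding c(2) TL[OF c(1)] using A0[OF c(1)] by simp
    qed
  next
    show "T (t \<oplus>\<^bsub>K\<^esub> u) = T t \<oplus>\<^bsub>K\<^esub> T u" if t: "t \<in> carrier K" and u: "u \<in> carrier K" for t u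
    proof -
      obtain c where c: "c \<in> ?A" "t = L c" using L_surj[OF t] by blast
      obtain d where d: "d \<in> ?A" "u = L d" using L_surj[OF u] by blast
      have "(\<lambda>i\<in>{..<m}. c i \<oplus>\<^bsub>F\<^esub> d i) \<in> ?A" using c d by (auto simp: PiE_iff)
      from TL[OF this] show ?thesis
        unfolding c(2) d(2) TL[OF c(1)] TL[OF d(1)] using A0[OF c(1)] A0[OF d(1)] m by (simp add: L_add[OF c(1) d(1)])
    qed
  next
    show "T (s \<otimes>\<^bsub>K\<^esub> t) = s \<otimes>\<^bsub>K\<^esub> T t" if s: "s \<in> h ` carrier F" and t: "t \<in> carrier K" for s t
    proof -
      obtain a where a: "a \<in> carrier F" "s = h a" using s by blast
      obtain c where c: "c \<in> ?A" "t = L c" using L_surj[OF t] by blast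
      have "(\<lambda>i\<in>{..<m}. a \<otimes>\<^bsub>F\<^esub> c i) \<in> ?A" using a c by (auto simp: PiE_iff)
      from TL[OF this] show ?thesis
        unfolding c(2) a(2) TL[OF c(1)] using A0[OF c(1)] a(1) m by (simp add: L_smult[OF a(1) c(1)])
    qed
  qed
  \<comment> \<open>Normalised representatives of the points; by \<open>Tx\<close>, the condition
    \<open>v 0 = \<one>\<close> says that \<open>T\<close> is one on \<open>x v\<close>.\<close>
  define Z where "Z = {v \<in> carrier V. v 0 = \<one>\<^bsub>F\<^esub> \<and> x v \<otimes>\<^bsub>K\<^esub> y v = \<one>\<^bsub>K\<^esub>}"
  have finV: "finite (carrier V)" using finF by (auto simp: carV intro!: finite_PiE)
  have Z_x_inj: "v = w" if "v \<in> Z" "w \<in> Z" "x v = x w" for v w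
  proof (rule xy_inj)
    show "y v = y w" using that K.inv_unique'[of "x v" "y v"] K.inv_unique'[of "x w" "y w"]
      by (auto simp: Z_def K.m_comm)
  qed (use that in \<open>auto simp: Z_def\<close>)
  have cardZ: "card Z = order F ^ (m - 1)"
  proof -
    let ?C = "\<Pi>\<^sub>E i\<in>{..<m}. if i = 0 then {\<one>\<^bsub>F\<^esub>} else carrier F"
    have CA: "?C \<subseteq> ?A" by (intro PiE_mono) simp
    have "bij_betw lo Z ?C"
    proof (rule bij_betwI')
      fix v w assume "v \<in> Z" "w \<in> Z"
      thus "lo v = lo w \<longleftrightarrow> v = w" using Z_x_inj by (auto simp: x_def)
    next
      fix v assume "v \<in> Z"
      thus "lo v \<in> ?C" using lohi(1)[of v] by (simp add: Z_def PiE_iff lo_def)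
    next
      fix c assume c: "c \<in> ?C"
      hence cA: "c \<in> ?A" using CA by blast
      have c0: "c 0 = \<one>\<^bsub>F\<^esub>" using PiE_mem[OF c, of 0] m by simp
      \<comment> \<open>Invertibility of the first half comes from \<open>T\<close> being one there,
        so each \<open>c\<close> in \<open>?C\<close> extends to exactly one vector of
        \<open>Z\<close>.\<close>
      have "L c \<noteq> \<zero>\<^bsub>K\<^esub>"
      proof
        assume "L c = \<zero>\<^bsub>K\<^esub>"
        hence "T (L c) = \<zero>\<^bsub>K\<^esub>" by simp
        thus False using TL[OF cA] c0 by simp
      qed
      hence inv: "inv\<^bsub>K\<^esub> (L c) \<in> carrier K" "L c \<otimes>\<^bsub>K\<^esub> inv\<^bsub>K\<^esub> (L c) = \<one>\<^bsub>K\<^esub>"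
        using L_closed[OF cA] by (auto simp: K.field_Units)
      obtain v where v: "v \<in> carrier V" "lo v = c" "y v = inv\<^bsub>K\<^esub> (L c)"
        using xy_surj[OF cA inv(1)] by blast
      have "v 0 = \<one>\<^bsub>F\<^esub>" using fun_cong[OF v(2), of 0] c0 m by (simp add: lo_def)
      hence "v \<in> Z" using v inv by (simp add: Z_def x_def)
      thus "\<exists>v\<in>Z. c = lo v" using v by blast
    qed
    hence "card Z = card ?C" by (rule bij_betw_same_card)
    also have "\<dots> = (\<Prod>i<m. if i = 0 then 1 else order F)"
      by (simp add: card_PiE Coset.order_def if_distrib cong: if_cong)
    also have "\<dots> = order F ^ (m - 1)"
      using m by (cases m) (simp_all add: prod.lessThan_Suc_shift del: prod.lessThan_Suc)
    finally show ?thesis .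
  qed
  define X where "X = (\<lambda>v. V.span {v}) ` Z"
  have ZV: "v \<in> carrier V" "v \<noteq> \<zero>\<^bsub>V\<^esub>" if "v \<in> Z" for v
    using that by (auto simp: Z_def zeroV)
  \<comment> \<open>Proportional vectors of \<open>Z\<close> agree in coordinate 0, so the scalar is
    one and distinct vectors span distinct points.\<close>
  have inj: "inj_on (\<lambda>v. V.span {v}) Z"
  proof (rule inj_onI)
    fix v w assume vw: "v \<in> Z" "w \<in> Z" "V.span {v} = V.span {w}"
    have "v \<in> V.span {w}" using V.span_self ZV vw by metis
    then obtain a where a: "a \<in> {w} \<rightarrow> carrier F" "V.lincomb a {w} = v"
      using V.finite_in_span[of "{w}" v] ZV vw by auto
    hence "v = a w \<odot>\<^bsub>V\<^esub> w" using ZV vw by (simp add: V.lincomb_def)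
    moreover from this have "v 0 = a w \<otimes>\<^bsub>F\<^esub> w 0" by (simp add: smultV)
    hence "a w = \<one>\<^bsub>F\<^esub>" using vw a by (simp add: Z_def)
    ultimately show "v = w" using ZV vw by simp
  qed
  have "card X = order F ^ (m - 1)" unfolding X_def by (simp add: card_image[OF inj] cardZ)
  moreover have "four_two_set F n X"
    unfolding four_two_set_def PG_points_def PG_planes_def PG_subspaces_def V_def[symmetric]
  proof (intro conjI ballI)
    show "X \<subseteq> {W. VectorSpace.subspace F W V \<and> vectorspace.dim F (V\<lparr>carrier := W\<rparr>) = 1}"
      using ZV by (auto simp: X_def V.dim_span_singleton intro!: V.span_is_subspace)
  next
    fix E assume "E \<in> {W. VectorSpace.subspace F W V \<and> vectorspace.dim F (V\<lparr>carrier := W\<rparr>) = 3}"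
    hence E: "VectorSpace.subspace F E V" "vectorspace.dim F (V\<lparr>carrier := E\<rparr>) = 3" by auto
    have EV: "E \<subseteq> carrier V"
      using V.is_module[OF E(1)] by (auto simp: submodule_def)
    have "finite Z" using finV by (simp add: Z_def)
    thus "finite {P \<in> X. P \<subseteq> E}" by (simp add: X_def)
    \<comment> \<open>Four vectors in a three-dimensional space are dependent;
      \<open>quadruple_coeffs_nonzero\<close> makes all four coefficients nonzero.\<close>
    have relation: "\<exists>a1 a2 a3 a4. a1 \<in> h ` carrier F \<and> a2 \<in> h ` carrier F \<and> a3 \<in> h ` carrier F \<and> a4 \<in> h ` carrier F \<and>
        a1 \<noteq> \<zero>\<^bsub>K\<^esub> \<and> a2 \<noteq> \<zero>\<^bsub>K\<^esub> \<and> a3 \<noteq> \<zero>\<^bsub>K\<^esub> \<and> a4 \<noteq> \<zero>\<^bsub>K\<^esub> \<and>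
        a1 \<otimes>\<^bsub>K\<^esub> x v1 \<oplus>\<^bsub>K\<^esub> a2 \<otimes>\<^bsub>K\<^esub> x v2 \<oplus>\<^bsub>K\<^esub> a3 \<otimes>\<^bsub>K\<^esub> x v3 \<oplus>\<^bsub>K\<^esub> a4 \<otimes>\<^bsub>K\<^esub> x v4 = \<zero>\<^bsub>K\<^esub> \<and>
        a1 \<otimes>\<^bsub>K\<^esub> y v1 \<oplus>\<^bsub>K\<^esub> a2 \<otimes>\<^bsub>K\<^esub> y v2 \<oplus>\<^bsub>K\<^esub> a3 \<otimes>\<^bsub>K\<^esub> y v3 \<oplus>\<^bsub>K\<^esub> a4 \<otimes>\<^bsub>K\<^esub> y v4 = \<zero>\<^bsub>K\<^esub>"
      if v: "v1 \<in> Z" "v2 \<in> Z" "v3 \<in> Z" "v4 \<in> Z" and vE: "{v1, v2, v3, v4} \<subseteq> E" and d: "distinct [v1, v2, v3, v4]"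
      for v1 v2 v3 v4
    proof -
      have vV: "v1 \<in> carrier V" "v2 \<in> carrier V" "v3 \<in> carrier V" "v4 \<in> carrier V" using v ZV by auto
      have "V.lin_dep {v1, v2, v3, v4}"
        using E vE d EV finV by (intro V.lin_dep_in_finite_subspace[of E]) (auto intro: finite_subset)
      then obtain a1 a2 a3 a4 where a: "a1 \<in> carrier F" "a2 \<in> carrier F" "a3 \<in> carrier F" "a4 \<in> carrier F"
        and nz: "\<not> (a1 = \<zero>\<^bsub>F\<^esub> \<and> a2 = \<zero>\<^bsub>F\<^esub> \<and> a3 = \<zero>\<^bsub>F\<^esub> \<and> a4 = \<zero>\<^bsub>F\<^esub>)"
        and rel: "a1 \<odot>\<^bsub>V\<^esub> v1 \<oplus>\<^bsub>V\<^esub> a2 \<odot>\<^bsub>V\<^esub> v2 \<oplus>\<^bsub>V\<^esub> a3 \<odot>\<^bsub>V\<^esub> v3 \<oplus>\<^bsub>V\<^esub> a4 \<odot>\<^bsub>V\<^esub> v4 = \<zero>\<^bsub>V\<^esub>"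
        using V.lin_dep_quadruple[OF vV d] by blast
      have rx: "h a1 \<otimes>\<^bsub>K\<^esub> x v1 \<oplus>\<^bsub>K\<^esub> h a2 \<otimes>\<^bsub>K\<^esub> x v2 \<oplus>\<^bsub>K\<^esub> h a3 \<otimes>\<^bsub>K\<^esub> x v3 \<oplus>\<^bsub>K\<^esub> h a4 \<otimes>\<^bsub>K\<^esub> x v4 = \<zero>\<^bsub>K\<^esub>"
        using arg_cong[OF rel, of x] a vV by (simp add: xy_add xy_smult xy_zero)
      have ry: "h a1 \<otimes>\<^bsub>K\<^esub> y v1 \<oplus>\<^bsub>K\<^esub> h a2 \<otimes>\<^bsub>K\<^esub> y v2 \<oplus>\<^bsub>K\<^esub> h a3 \<otimes>\<^bsub>K\<^esub> y v3 \<oplus>\<^bsub>K\<^esub> h a4 \<otimes>\<^bsub>K\<^esub> y v4 = \<zero>\<^bsub>K\<^esub>"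
        using arg_cong[OF rel, of y] a vV by (simp add: xy_add xy_smult xy_zero)
      have dx: "distinct [x v1, x v2, x v3, x v4]" using d v Z_x_inj by auto
      have T1: "T (x v1) = \<one>\<^bsub>K\<^esub>" "T (x v2) = \<one>\<^bsub>K\<^esub>" "T (x v3) = \<one>\<^bsub>K\<^esub>" "T (x v4) = \<one>\<^bsub>K\<^esub>"
        using v by (auto simp: Z_def Tx)
      have p: "x v1 \<otimes>\<^bsub>K\<^esub> y v1 = \<one>\<^bsub>K\<^esub>" "x v2 \<otimes>\<^bsub>K\<^esub> y v2 = \<one>\<^bsub>K\<^esub>" "x v3 \<otimes>\<^bsub>K\<^esub> y v3 = \<one>\<^bsub>K\<^esub>" "x v4 \<otimes>\<^bsub>K\<^esub> y v4 = \<one>\<^bsub>K\<^esub>"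
        using v by (auto simp: Z_def)
      have "\<not> (h a1 = \<zero>\<^bsub>K\<^esub> \<and> h a2 = \<zero>\<^bsub>K\<^esub> \<and> h a3 = \<zero>\<^bsub>K\<^esub> \<and> h a4 = \<zero>\<^bsub>K\<^esub>)" using nz h0[OF a(1)] h0[OF a(2)] h0[OF a(3)] h0[OF a(4)] by blast
      note nz' = quadruple_coeffs_nonzero[OF a[THEN imageI] xy_closed(1)[OF vV(1)] xy_closed(1)[OF vV(2)]
          xy_closed(1)[OF vV(3)] xy_closed(1)[OF vV(4)] xy_closed(2)[OF vV(1)] xy_closed(2)[OF vV(2)]
          xy_closed(2)[OF vV(3)] xy_closed(2)[OF vV(4)] p T1 dx rx ry this]
      show ?thesis
        by (rule exI[of _ "h a1"], rule exI[of _ "h a2"], rule exI[of _ "h a3"], rule exI[of _ "h a4"])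
          (intro conjI imageI a nz' rx ry)
    qed
    show "card {P \<in> X. P \<subseteq> E} \<le> 4"
    proof (rule ccontr)
      assume "\<not> ?thesis"
      moreover have "{P \<in> X. P \<subseteq> E} \<subseteq> (\<lambda>v. V.span {v}) ` (Z \<inter> E)"
      proof
        fix P assume "P \<in> {P \<in> X. P \<subseteq> E}"
        then obtain v where v: "v \<in> Z" "P = V.span {v}" "P \<subseteq> E" by (auto simp: X_def)
        thus "P \<in> (\<lambda>v. V.span {v}) ` (Z \<inter> E)" using V.span_self[OF ZV(1)[OF v(1)]] by blast
      qed
      hence "card {P \<in> X. P \<subseteq> E} \<le> card (Z \<inter> E)"
        using \<open>finite Z\<close> by (meson card_image_le card_mono finite_Int finite_imageI le_trans)
      ultimately have "card (Z \<inter> E) \<ge> 5" by simp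
      then obtain v1 v2 v3 v4 v5 where vs: "{v1, v2, v3, v4, v5} \<subseteq> Z \<inter> E" and d: "distinct [v1, v2, v3, v4, v5]"
        by (rule card_ge_5_distinct)
      have v: "v1 \<in> Z" "v2 \<in> Z" "v3 \<in> Z" "v4 \<in> Z" "v5 \<in> Z"
        and vE: "{v1, v2, v3, v4} \<subseteq> E" "{v1, v2, v3, v5} \<subseteq> E" using vs by auto
      have d': "distinct [v1, v2, v3, v4]" "distinct [v1, v2, v3, v5]" using d by auto
      obtain l1 l2 l3 l4 where l: "l1 \<in> h ` carrier F" "l2 \<in> h ` carrier F" "l3 \<in> h ` carrier F" "l4 \<in> h ` carrier F"
          "l1 \<noteq> \<zero>\<^bsub>K\<^esub>" "l2 \<noteq> \<zero>\<^bsub>K\<^esub>" "l3 \<noteq> \<zero>\<^bsub>K\<^esub>" "l4 \<noteq> \<zero>\<^bsub>K\<^esub>"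
        and lx: "l1 \<otimes>\<^bsub>K\<^esub> x v1 \<oplus>\<^bsub>K\<^esub> l2 \<otimes>\<^bsub>K\<^esub> x v2 \<oplus>\<^bsub>K\<^esub> l3 \<otimes>\<^bsub>K\<^esub> x v3 \<oplus>\<^bsub>K\<^esub> l4 \<otimes>\<^bsub>K\<^esub> x v4 = \<zero>\<^bsub>K\<^esub>"
        and ly: "l1 \<otimes>\<^bsub>K\<^esub> y v1 \<oplus>\<^bsub>K\<^esub> l2 \<otimes>\<^bsub>K\<^esub> y v2 \<oplus>\<^bsub>K\<^esub> l3 \<otimes>\<^bsub>K\<^esub> y v3 \<oplus>\<^bsub>K\<^esub> l4 \<otimes>\<^bsub>K\<^esub> y v4 = \<zero>\<^bsub>K\<^esub>"
        using relation[OF v(1-4) vE(1) d'(1)] by blast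
      obtain m1 m2 m3 m5 where m: "m1 \<in> h ` carrier F" "m2 \<in> h ` carrier F" "m3 \<in> h ` carrier F" "m5 \<in> h ` carrier F"
          "m1 \<noteq> \<zero>\<^bsub>K\<^esub>" "m2 \<noteq> \<zero>\<^bsub>K\<^esub>" "m3 \<noteq> \<zero>\<^bsub>K\<^esub>" "m5 \<noteq> \<zero>\<^bsub>K\<^esub>"
        and mx: "m1 \<otimes>\<^bsub>K\<^esub> x v1 \<oplus>\<^bsub>K\<^esub> m2 \<otimes>\<^bsub>K\<^esub> x v2 \<oplus>\<^bsub>K\<^esub> m3 \<otimes>\<^bsub>K\<^esub> x v3 \<oplus>\<^bsub>K\<^esub> m5 \<otimes>\<^bsub>K\<^esub> x v5 = \<zero>\<^bsub>K\<^esub>"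
        and my: "m1 \<otimes>\<^bsub>K\<^esub> y v1 \<oplus>\<^bsub>K\<^esub> m2 \<otimes>\<^bsub>K\<^esub> y v2 \<oplus>\<^bsub>K\<^esub> m3 \<otimes>\<^bsub>K\<^esub> y v3 \<oplus>\<^bsub>K\<^esub> m5 \<otimes>\<^bsub>K\<^esub> y v5 = \<zero>\<^bsub>K\<^esub>"
        using relation[OF v(1-3,5) vE(2) d'(2)] by blast
      have Z: "x v \<in> carrier K" "y v \<in> carrier K" "x v \<otimes>\<^bsub>K\<^esub> y v = \<one>\<^bsub>K\<^esub>" "T (x v) = \<one>\<^bsub>K\<^esub>" if "v \<in> Z" for v
        using that by (simp_all add: Z_def Tx)
      have ne: "x v2 \<noteq> x v3" "x v1 \<noteq> x v5" "x v4 \<noteq> x v5"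
        using d Z_x_inj[OF v(2,3)] Z_x_inj[OF v(1,5)] Z_x_inj[OF v(4,5)] by auto
      show False
        by (rule quintuple_rank[OF l m Z(1)[OF v(1)] Z(1)[OF v(2)] Z(1)[OF v(3)] Z(1)[OF v(4)] Z(1)[OF v(5)]
              Z(2)[OF v(1)] Z(2)[OF v(2)] Z(2)[OF v(3)] Z(2)[OF v(4)] Z(2)[OF v(5)]
              Z(3)[OF v(1)] Z(3)[OF v(2)] Z(3)[OF v(3)] Z(3)[OF v(4)] Z(3)[OF v(5)]
              Z(4)[OF v(1)] Z(4)[OF v(2)] Z(4)[OF v(3)] Z(4)[OF v(4)] Z(4)[OF v(5)]
              ne lx ly mx my])
    qed
  qed
  ultimately show ?thesis by blast
qed

text \<open>The extension field is \<open>F (q ^ m)\<close>, available because \<open>q ^ m\<close>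
  is again a prime power. Along prime powers the asymptotic formula holds with equality, the set
  having exactly \<open>q ^ (m - 1)\<close> points.\<close>

theorem theorem11:
  fixes m n :: nat and F :: "nat \<Rightarrow> ('a, 'b) ring_scheme"
  assumes "m \<ge> 2" and "n = 2 * m - 1"
    and "\<And>q. primepow q \<Longrightarrow> field (F q)"
    and "\<And>q. primepow q \<Longrightarrow> order (F q) = q"
  shows "\<exists>X :: nat \<Rightarrow> (nat \<Rightarrow> 'a) set set.
           (\<forall>q. primepow q \<longrightarrow> four_two_set (F q) n (X q)) \<and>
           (\<lambda>q. real (card (X q))) \<sim>[inf at_top (principal {q. primepow q})]
             (\<lambda>q. real q powr ((real n - 1) / 2))"
proof -
  have ex: "\<exists>X. four_two_set (F q) n X \<and> card X = q ^ (m - 1)" if q: "primepow q" for q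
  proof -
    have m: "m > 0" using assms(1) by simp
    have qm: "primepow (q ^ m)" using q m primepow_gt_0_nat[OF q] by (simp add: primepow_power_iff_nat)
    have q0: "q > 0" using q by (rule primepow_gt_0_nat)
    have "finite (carrier (F q))"
      using assms(4)[OF q] q0 by (intro card_ge_0_finite) (simp add: Coset.order_def)
    moreover obtain h where "h \<in> ring_hom (F q) (F (q ^ m))"
      using finite_field_embedding[OF assms(3)[OF q] assms(3)[OF qm] q assms(4)[OF q] assms(4)[OF qm] m] .
    ultimately have "\<exists>X. four_two_set (F q) n X \<and> card X = order (F q) ^ (m - 1)"
      using assms m q qm by (intro four_two_set_from_extension[of "F q" "F (q ^ m)" h m n]) auto
    thus ?thesis using assms(4)[OF q] by simp
  qed
  define X where "X q = (SOME X. four_two_set (F q) n X \<and> card X = q ^ (m - 1))" for q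
  have X: "four_two_set (F q) n (X q)" "card (X q) = q ^ (m - 1)" if "primepow q" for q
    using someI_ex[OF ex[OF that]] by (auto simp: X_def)
  have expo: "(real n - 1) / 2 = real (m - 1)" using assms(1,2) by (simp add: of_nat_diff)
  have "real (card (X q)) = real q powr ((real n - 1) / 2)" if "primepow q" for q
    using that X(2)[OF that] primepow_gt_0_nat[OF that] unfolding expo by (simp add: powr_realpow)
  hence "(\<lambda>q. real (card (X q))) \<sim>[inf at_top (principal {q. primepow q})]
      (\<lambda>q. real q powr ((real n - 1) / 2))"
    by (intro asymp_equiv_refl_ev) (simp add: eventually_inf_principal)
  with X(1) show ?thesis by blast
qed

end
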